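(* The following two constructions are mutually inverse. * From a (general) action operad $(G_\bullet,\pi,\{\circ_i\}_i,\mathrm{id})$ to a quintuple $(G_\bullet,\iota,\zeta,\kappa,\pi)$: keep the groups $G_n$ and the homomorphisms $\pi_n$, and put $\kappa^n_j(g)=g\circ_j e_2$, $\zeta_n(g)=e_2\circ_2 g$, $\iota_n(g)=e_2\circ_1 g$ for $g\in G_n$, where $e_n$ is the identity of $G_n$. * From an operadic cloning system $(G_\bullet,\iota,\zeta,\kappa,\pi)$ to a quadruple $(G_\bullet,\pi,\{\circ_i\}_i,\mathrm{id})$: keep the groups $G_n$ and the homomorphisms $\pi_n$, and put $f\circ_i g=\kappa^n_i(m)(f)\cdot\nu^m_i(n)(g)$ for $f\in G_n$, $g\in G_m$, $1\le i\le n$, and $\mathrm{id}=e_1$. They give an explicit bijective correspondence between action operads and restricted operadic cloning systems, and an explicit bijective correspondence between general action operads and operadic cloning systems.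
   Context: **Symmetric groups.** $\Sigma_n$ is the group of permutations of $\{1,\dots,n\}$, with product $(\sigma\tau)(i)=\sigma(\tau(i))$. Define maps $\Sigma_n\to\Sigma_{n+1}$: $\lambda_n(\sigma)$ agrees with $\sigma$ on $\{1,\dots,n\}$ and fixes $n+1$; $\rho_n(\sigma)(1)=1$ and $\rho_n(\sigma)(i)=\sigma(i-1)+1$ for $2\le i\le n+1$; and, for $1\le j\le n$, $c^n_j(\sigma)(i)$ equals $\sigma(i)$ if $i\le j$ and $\sigma(i)\le\sigma(j)$; $\sigma(i)+1$ if $i<j$ and $\sigma(i)>\sigma(j)$; $\sigma(i-1)$ if $i>j+1$ and $\sigma(i-1)<\sigma(j)$; $\sigma(i-1)+1$ if $i\ge j+1$ and $\sigma(i-1)\ge\sigma(j)$. (This duplicates the $j$-th strand.) The partial compositions $\circ_i:\Sigma_n\times\Sigma_m\to\Sigma_{n+m-1}$ insert $\tau$ in $\sigma$ at the $i$-th place as a block: $(\sigma\circ_i\tau)(i-1+t)=\sigma(i)-1+\tau(t)$ for $1\le t\le m$; and for $k\ne i$, with $k'=k$ if $k<i$ and $k'=k+m-1$ if $k>i$, $(\sigma\circ_i\tau)(k')=\sigma(k)$ if $\sigma(k)<\sigma(i)$ and $\sigma(k)+m-1$ if $\sigma(k)>\sigma(i)$. These make $\{\Sigma_n\}_{n\ge1}$ a non-symmetric operad of sets. **Action operads.** An *action operad* is $(G_\bullet,\pi,\{\circ_i\}_i,\mathrm{id})$ with (1) $G_\bullet=\{G_n\}_{n\ge1}$ a family of groups,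 $\mathrm{id}\in G_1$, and maps of sets $\circ_i:G_n\times G_m\to G_{n+m-1}$ ($1\le i\le n$) forming a non-symmetric operad of sets (no arity $0$): for $f\in G_n$, $g\in G_m$, $h\in G_l$, $(f\circ_i g)\circ_j h$ equals $(f\circ_j h)\circ_{i+l-1}g$ if $j<i$, $(f\circ_{j-m+1}h)\circ_i g$ if $j\ge i+m$, and $f\circ_i(g\circ_{j-i+1}h)$ if $i\le j\le i+m-1$; moreover $f\circ_i\mathrm{id}=f$ and $\mathrm{id}\circ_1 g=g$; (2) $\pi=\{\pi_n:G_n\to\Sigma_n\}$ is a map of operads which is levelwise a group homomorphism; that is, each $\pi_n$ is a group homomorphism, $\pi_{n+m-1}(g\circ_i h)=\pi_n(g)\circ_i\pi_m(h)$ and $\pi_1(\mathrm{id})=\mathrm{id}$; (3) $(f f')\circ_i(g g')=(f\circ_{\pi_n(f')(i)}g)\cdot(f'\circ_i g')$ for all $f,f'\in G_n$, $g,g'\in G_m$, $1\le i\le n$. A *general action operad* is such a tuple satisfying (1), (3) and, in place of (2): (2') each $\pi_n:G_n\to\Sigma_n$ is a group homomorphism such that, for $g\in G_n$ and $h\in G_m$, the permutations $\pi_n(g)\circ_i\pi_m(h)$ and $\pi_{n+m-1}(g\circ_i h)$ coincide on $\{1,\dots,n+m-1\}\setminus\{i,\dots,i+m-1\}$. **Cloning systems.** A *cloning system* $(G_\bullet,\iota,\kappa,\pi)$ consists of groups $G_n$ ($n\ge1$), homomorphisms $\iota_n:G_n\to G_{n+1}$ and $\pi_n:G_n\to\Sigma_n$,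 and maps of sets $\kappa^n_j:G_n\to G_{n+1}$ ($1\le j\le n$) such that for all admissible indices and elements: (i) $\pi_{n+1}\iota_n=\lambda_n\pi_n$; (ii) $\pi_{n+1}(\kappa^n_j(g))(i)=c^n_j(\pi_n(g))(i)$ for all $i\ne j,j+1$; (iii) $\iota_{n+1}\kappa^n_j=\kappa^{n+1}_j\iota_n$; (iv) $\kappa^{n+1}_{j+1}\kappa^n_l=\kappa^{n+1}_l\kappa^n_j$ for $l<j\le n$; (v) $\kappa^n_j(gh)=\kappa^n_{\pi_n(h)(j)}(g)\,\kappa^n_j(h)$. A *bilateral cloning system* $(G_\bullet,\iota,\zeta,\kappa,\pi)$ is a cloning system together with homomorphisms $\zeta_n:G_n\to G_{n+1}$ such that (iv+) $\kappa^{n+1}_{j+1}\kappa^n_j=\kappa^{n+1}_j\kappa^n_j$; (vii) $\iota_{n+1}\iota_n=\kappa^{n+1}_{n+1}\iota_n$; (i') $\pi_{n+1}\zeta_n=\rho_n\pi_n$; (iii') $\zeta_{n+1}\kappa^n_j=\kappa^{n+1}_{j+1}\zeta_n$; (vi) $\zeta_{n+1}\iota_n=\iota_{n+1}\zeta_n$; (vii') $\zeta_{n+1}\zeta_n=\kappa^{n+1}_1\zeta_n$. It is *restricted* if moreover (ii+) $\pi_{n+1}\kappa^n_j=c^n_j\pi_n$ for all $n,j$. Put $\iota_n(r)=\iota_{n+r-1}\cdots\iota_n:G_n\to G_{n+r}$, $\zeta_n(l)=\zeta_{n+l-1}\cdots\zeta_n:G_n\to G_{n+l}$, $\kappa^n_j(m)=\kappa^{n+m-2}_j\cdots\kappa^n_j:G_n\to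 G_{n+m-1}$ and $\nu^n_j(m)=\zeta_{n+m-j}(j-1)\circ\iota_n(m-j):G_n\to G_{n+m-1}$ for $1\le j\le m$, with $\iota_n(0)=\zeta_n(0)=\kappa^n_j(1)=\mathrm{id}$. A bilateral cloning system is *operadic* if for all $m,n\ge1$, $g\in G_n$, $h\in G_m$: (viii) $\kappa^n_i(m)(g)\cdot\nu^m_i(n)(h)=\nu^m_{\pi_n(g)(i)}(n)(h)\cdot\kappa^n_i(m)(g)$ for $1\le i\le n$; (ix) $\iota_n(m)(g)\cdot\zeta_m(n)(h)=\zeta_m(n)(h)\cdot\iota_n(m)(g)$.
   Formalization: The bijection with operadic cloning systems is for general action operads also satisfying π_{n+m-1}(e_n∘_i h)=π_n(e_n)∘_i π_m(h) for all n,m,i,h; otherwise axiom (i) can fail, e.g. G_n=Z/2 acting by order reversal, f∘_i g=f for n≥2 and fg for n=1. *)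

theory Defs
  imports "HOL-Algebra.Sym_Groups" "HOL-Library.FuncSet"
begin

text \<open>
  The symmetric group on \<open>{1..n}\<close> is \<^const>\<open>sym_group\<close>: its elements are functions on \<open>nat\<close> that
  fix every point outside \<open>{1..n}\<close>, multiplied by composition.  Every function below is therefore
  extended by the identity outside the relevant interval.
\<close>

definition sym_lambda :: "nat \<Rightarrow> (nat \<Rightarrow> nat) \<Rightarrow> nat \<Rightarrow> nat" where
  "sym_lambda n \<sigma> i = (if i \<in> {1..n} then \<sigma> i else i)"

definition sym_rho :: "nat \<Rightarrow> (nat \<Rightarrow> nat) \<Rightarrow> nat \<Rightarrow> nat" where
  "sym_rho n \<sigma> i = (if i \<in> {2..n+1} then \<sigma> (i - 1) + 1 else i)"

definition sym_clone :: "nat \<Rightarrow> nat \<Rightarrow> (nat \<Rightarrow> nat) \<Rightarrow> nat \<Rightarrow> nat" where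
  "sym_clone n j \<sigma> i =
    (if i \<notin> {1..n+1} then i
     else if i \<le> j then (if \<sigma> i \<le> \<sigma> j then \<sigma> i else \<sigma> i + 1)
     else (if \<sigma> (i - 1) < \<sigma> j then \<sigma> (i - 1) else \<sigma> (i - 1) + 1))"

text \<open>
  \<open>sym_comp n m i \<sigma> \<tau>\<close> is the partial composition of \<open>\<sigma>\<close> (arity \<open>n\<close>) with \<open>\<tau>\<close> (arity \<open>m\<close>) at
  place \<open>i\<close>.  Outside the inserted block, \<open>k\<close> below is the place of \<open>\<sigma>\<close> that \<open>k'\<close> comes from.
\<close>

definition sym_comp :: "nat \<Rightarrow> nat \<Rightarrow> nat \<Rightarrow> (nat \<Rightarrow> nat) \<Rightarrow> (nat \<Rightarrow> nat) \<Rightarrow> nat \<Rightarrow> nat" where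
  "sym_comp n m i \<sigma> \<tau> k' =
    (if k' \<notin> {1..n+m-1} then k'
     else if k' \<in> {i..i+m-1} then \<sigma> i - 1 + \<tau> (k' - i + 1)
     else let k = (if k' < i then k' else k' - (m - 1))
          in if \<sigma> k < \<sigma> i then \<sigma> k else \<sigma> k + (m - 1))"

text \<open>
  Arities are explicit arguments: \<open>comp n m i f g\<close> is the partial composition of \<open>f\<close> in \<open>G n\<close> and
  \<open>g\<close> in \<open>G m\<close> at place \<open>i\<close>.  The maps of sets that make up a structure are taken in extensional
  function spaces, so that two structures are equal as tuples as soon as these maps agree on
  their domains; without this, no correspondence of tuples could be bijective.  The groups and the
  homomorphisms \<open>\<pi>\<close> need no such normalisation, since both constructions keep them.
  Nothing is assumed about \<open>G 0\<close>.
\<close>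

locale groups_over_sym =
  fixes G :: "nat \<Rightarrow> 'a monoid" and \<pi> :: "nat \<Rightarrow> 'a \<Rightarrow> nat \<Rightarrow> nat"
  assumes group: "n \<ge> 1 \<Longrightarrow> group (G n)"
    and pi_hom: "n \<ge> 1 \<Longrightarrow> \<pi> n \<in> hom (G n) (sym_group n)"

locale operad_over_sym = groups_over_sym G \<pi>
  for G :: "nat \<Rightarrow> 'a monoid" and \<pi> :: "nat \<Rightarrow> 'a \<Rightarrow> nat \<Rightarrow> nat" +
  fixes comp :: "nat \<Rightarrow> nat \<Rightarrow> nat \<Rightarrow> 'a \<Rightarrow> 'a \<Rightarrow> 'a" and unit :: 'a
  assumes comp_type: "comp \<in> (\<Pi>\<^sub>E n\<in>{1..}. \<Pi>\<^sub>E m\<in>{1..}. \<Pi>\<^sub>E i\<in>{1..n}.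
            carrier (G n) \<rightarrow>\<^sub>E carrier (G m) \<rightarrow>\<^sub>E carrier (G (n + m - 1)))"
    and unit_closed: "unit \<in> carrier (G 1)"
    and assoc_left: "\<lbrakk>n \<ge> 1; m \<ge> 1; l \<ge> 1; f \<in> carrier (G n); g \<in> carrier (G m); h \<in> carrier (G l);
            i \<in> {1..n}; j \<in> {1..n+m-1}; j < i\<rbrakk> \<Longrightarrow>
            comp (n + m - 1) l j (comp n m i f g) h
              = comp (n + l - 1) m (i + l - 1) (comp n l j f h) g"
    and assoc_right: "\<lbrakk>n \<ge> 1; m \<ge> 1; l \<ge> 1; f \<in> carrier (G n); g \<in> carrier (G m); h \<in> carrier (G l);
            i \<in> {1..n}; j \<in> {1..n+m-1}; j \<ge> i + m\<rbrakk> \<Longrightarrow>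
            comp (n + m - 1) l j (comp n m i f g) h
              = comp (n + l - 1) m i (comp n l (j - m + 1) f h) g"
    and assoc_inner: "\<lbrakk>n \<ge> 1; m \<ge> 1; l \<ge> 1; f \<in> carrier (G n); g \<in> carrier (G m); h \<in> carrier (G l);
            i \<in> {1..n}; j \<in> {1..n+m-1}; i \<le> j; j \<le> i + m - 1\<rbrakk> \<Longrightarrow>
            comp (n + m - 1) l j (comp n m i f g) h
              = comp n (m + l - 1) i f (comp m l (j - i + 1) g h)"
    and comp_unit: "\<lbrakk>n \<ge> 1; f \<in> carrier (G n); i \<in> {1..n}\<rbrakk> \<Longrightarrow> comp n 1 i f unit = f"
    and unit_comp: "\<lbrakk>m \<ge> 1; g \<in> carrier (G m)\<rbrakk> \<Longrightarrow> comp 1 m 1 unit g = g"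
    and comp_mult: "\<lbrakk>n \<ge> 1; m \<ge> 1; f \<in> carrier (G n); f' \<in> carrier (G n);
            g \<in> carrier (G m); g' \<in> carrier (G m); i \<in> {1..n}\<rbrakk> \<Longrightarrow>
            comp n m i (f \<otimes>\<^bsub>G n\<^esub> f') (g \<otimes>\<^bsub>G m\<^esub> g')
              = comp n m (\<pi> n f' i) f g \<otimes>\<^bsub>G (n + m - 1)\<^esub> comp n m i f' g'"

locale action_operad = operad_over_sym +
  assumes pi_comp: "\<lbrakk>n \<ge> 1; m \<ge> 1; g \<in> carrier (G n); h \<in> carrier (G m); i \<in> {1..n}\<rbrakk> \<Longrightarrow>
            \<pi> (n + m - 1) (comp n m i g h) = sym_comp n m i (\<pi> n g) (\<pi> m h)"
    and pi_unit: "\<pi> 1 unit = id"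

locale general_action_operad = operad_over_sym +
  assumes pi_comp_outside: "\<lbrakk>n \<ge> 1; m \<ge> 1; g \<in> carrier (G n); h \<in> carrier (G m); i \<in> {1..n};
            k \<in> {1..n+m-1} - {i..i+m-1}\<rbrakk> \<Longrightarrow>
            sym_comp n m i (\<pi> n g) (\<pi> m h) k = \<pi> (n + m - 1) (comp n m i g h) k"

locale cloning_system = groups_over_sym G \<pi>
  for G :: "nat \<Rightarrow> 'a monoid" and \<pi> :: "nat \<Rightarrow> 'a \<Rightarrow> nat \<Rightarrow> nat" +
  fixes \<iota> :: "nat \<Rightarrow> 'a \<Rightarrow> 'a" and \<kappa> :: "nat \<Rightarrow> nat \<Rightarrow> 'a \<Rightarrow> 'a"
  assumes iota_type: "\<iota> \<in> (\<Pi>\<^sub>E n\<in>{1..}. carrier (G n) \<rightarrow>\<^sub>E carrier (G (n + 1)))"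
    and iota_hom: "n \<ge> 1 \<Longrightarrow> \<iota> n \<in> hom (G n) (G (n + 1))"
    and kappa_type: "\<kappa> \<in> (\<Pi>\<^sub>E n\<in>{1..}. \<Pi>\<^sub>E j\<in>{1..n}. carrier (G n) \<rightarrow>\<^sub>E carrier (G (n + 1)))"
    and pi_iota: "\<lbrakk>n \<ge> 1; g \<in> carrier (G n)\<rbrakk> \<Longrightarrow> \<pi> (n + 1) (\<iota> n g) = sym_lambda n (\<pi> n g)"
    and pi_kappa_outside: "\<lbrakk>n \<ge> 1; g \<in> carrier (G n); j \<in> {1..n}; i \<in> {1..n+1} - {j, j + 1}\<rbrakk> \<Longrightarrow>
            \<pi> (n + 1) (\<kappa> n j g) i = sym_clone n j (\<pi> n g) i"
    and iota_kappa: "\<lbrakk>n \<ge> 1; g \<in> carrier (G n); j \<in> {1..n}\<rbrakk> \<Longrightarrow>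
            \<iota> (n + 1) (\<kappa> n j g) = \<kappa> (n + 1) j (\<iota> n g)"
    and kappa_kappa: "\<lbrakk>n \<ge> 1; g \<in> carrier (G n); 1 \<le> l; l < j; j \<le> n\<rbrakk> \<Longrightarrow>
            \<kappa> (n + 1) (j + 1) (\<kappa> n l g) = \<kappa> (n + 1) l (\<kappa> n j g)"
    and kappa_mult: "\<lbrakk>n \<ge> 1; g \<in> carrier (G n); h \<in> carrier (G n); j \<in> {1..n}\<rbrakk> \<Longrightarrow>
            \<kappa> n j (g \<otimes>\<^bsub>G n\<^esub> h) = \<kappa> n (\<pi> n h j) g \<otimes>\<^bsub>G (n + 1)\<^esub> \<kappa> n j h"

locale bilateral_cloning_system = cloning_system G \<pi> \<iota> \<kappa>
  for G :: "nat \<Rightarrow> 'a monoid" and \<pi> :: "nat \<Rightarrow> 'a \<Rightarrow> nat \<Rightarrow> nat"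
    and \<iota> :: "nat \<Rightarrow> 'a \<Rightarrow> 'a" and \<kappa> :: "nat \<Rightarrow> nat \<Rightarrow> 'a \<Rightarrow> 'a" +
  fixes \<zeta> :: "nat \<Rightarrow> 'a \<Rightarrow> 'a"
  assumes zeta_type: "\<zeta> \<in> (\<Pi>\<^sub>E n\<in>{1..}. carrier (G n) \<rightarrow>\<^sub>E carrier (G (n + 1)))"
    and zeta_hom: "n \<ge> 1 \<Longrightarrow> \<zeta> n \<in> hom (G n) (G (n + 1))"
    and kappa_kappa_same: "\<lbrakk>n \<ge> 1; g \<in> carrier (G n); j \<in> {1..n}\<rbrakk> \<Longrightarrow>
            \<kappa> (n + 1) (j + 1) (\<kappa> n j g) = \<kappa> (n + 1) j (\<kappa> n j g)"
    and iota_iota: "\<lbrakk>n \<ge> 1; g \<in> carrier (G n)\<rbrakk> \<Longrightarrow>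
            \<iota> (n + 1) (\<iota> n g) = \<kappa> (n + 1) (n + 1) (\<iota> n g)"
    and pi_zeta: "\<lbrakk>n \<ge> 1; g \<in> carrier (G n)\<rbrakk> \<Longrightarrow> \<pi> (n + 1) (\<zeta> n g) = sym_rho n (\<pi> n g)"
    and zeta_kappa: "\<lbrakk>n \<ge> 1; g \<in> carrier (G n); j \<in> {1..n}\<rbrakk> \<Longrightarrow>
            \<zeta> (n + 1) (\<kappa> n j g) = \<kappa> (n + 1) (j + 1) (\<zeta> n g)"
    and zeta_iota: "\<lbrakk>n \<ge> 1; g \<in> carrier (G n)\<rbrakk> \<Longrightarrow> \<zeta> (n + 1) (\<iota> n g) = \<iota> (n + 1) (\<zeta> n g)"
    and zeta_zeta: "\<lbrakk>n \<ge> 1; g \<in> carrier (G n)\<rbrakk> \<Longrightarrow>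
            \<zeta> (n + 1) (\<zeta> n g) = \<kappa> (n + 1) 1 (\<zeta> n g)"

text \<open>
  \<open>iter_up F n r\<close> is the composite \<open>F (n + r - 1) \<circ> \<dots> \<circ> F n\<close> of \<open>r\<close> consecutive maps.
\<close>

primrec iter_up :: "(nat \<Rightarrow> 'a \<Rightarrow> 'a) \<Rightarrow> nat \<Rightarrow> nat \<Rightarrow> 'a \<Rightarrow> 'a" where
  "iter_up F n 0 g = g"
| "iter_up F n (Suc r) g = F (n + r) (iter_up F n r g)"

definition kappa_iter :: "(nat \<Rightarrow> nat \<Rightarrow> 'a \<Rightarrow> 'a) \<Rightarrow> nat \<Rightarrow> nat \<Rightarrow> nat \<Rightarrow> 'a \<Rightarrow> 'a" where
  "kappa_iter \<kappa> n j m = iter_up (\<lambda>k. \<kappa> k j) n (m - 1)"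

definition nu :: "(nat \<Rightarrow> 'a \<Rightarrow> 'a) \<Rightarrow> (nat \<Rightarrow> 'a \<Rightarrow> 'a) \<Rightarrow> nat \<Rightarrow> nat \<Rightarrow> nat \<Rightarrow> 'a \<Rightarrow> 'a" where
  "nu \<iota> \<zeta> n j m = iter_up \<zeta> (n + m - j) (j - 1) \<circ> iter_up \<iota> n (m - j)"

locale operadic_cloning_system = bilateral_cloning_system +
  assumes kappa_nu: "\<lbrakk>m \<ge> 1; n \<ge> 1; g \<in> carrier (G n); h \<in> carrier (G m); i \<in> {1..n}\<rbrakk> \<Longrightarrow>
            kappa_iter \<kappa> n i m g \<otimes>\<^bsub>G (n + m - 1)\<^esub> nu \<iota> \<zeta> m i n h
              = nu \<iota> \<zeta> m (\<pi> n g i) n h \<otimes>\<^bsub>G (n + m - 1)\<^esub> kappa_iter \<kappa> n i m g"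
    and iota_zeta_commute: "\<lbrakk>m \<ge> 1; n \<ge> 1; g \<in> carrier (G n); h \<in> carrier (G m)\<rbrakk> \<Longrightarrow>
            iter_up \<iota> n m g \<otimes>\<^bsub>G (n + m)\<^esub> iter_up \<zeta> m n h
              = iter_up \<zeta> m n h \<otimes>\<^bsub>G (n + m)\<^esub> iter_up \<iota> n m g"

locale restricted_operadic_cloning_system = operadic_cloning_system +
  assumes pi_kappa: "\<lbrakk>n \<ge> 1; g \<in> carrier (G n); j \<in> {1..n}\<rbrakk> \<Longrightarrow>
            \<pi> (n + 1) (\<kappa> n j g) = sym_clone n j (\<pi> n g)"

type_synonym 'a operad_data =
  "(nat \<Rightarrow> 'a monoid) \<times> (nat \<Rightarrow> 'a \<Rightarrow> nat \<Rightarrow> nat) \<times> (nat \<Rightarrow> nat \<Rightarrow> nat \<Rightarrow> 'a \<Rightarrow> 'a \<Rightarrow> 'a) \<times> 'a"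

type_synonym 'a cloning_data =
  "(nat \<Rightarrow> 'a monoid) \<times> (nat \<Rightarrow> 'a \<Rightarrow> 'a) \<times> (nat \<Rightarrow> 'a \<Rightarrow> 'a) \<times> (nat \<Rightarrow> nat \<Rightarrow> 'a \<Rightarrow> 'a)
    \<times> (nat \<Rightarrow> 'a \<Rightarrow> nat \<Rightarrow> nat)"

definition action_operads :: "'a operad_data set" where
  "action_operads = {(G, \<pi>, comp, unit). action_operad G \<pi> comp unit}"

definition general_action_operads :: "'a operad_data set" where
  "general_action_operads = {(G, \<pi>, comp, unit). general_action_operad G \<pi> comp unit}"

definition operadic_cloning_systems :: "'a cloning_data set" where
  "operadic_cloning_systems = {(G, \<iota>, \<zeta>, \<kappa>, \<pi>). operadic_cloning_system G \<pi> \<iota> \<kappa> \<zeta>}"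

definition restricted_operadic_cloning_systems :: "'a cloning_data set" where
  "restricted_operadic_cloning_systems =
    {(G, \<iota>, \<zeta>, \<kappa>, \<pi>). restricted_operadic_cloning_system G \<pi> \<iota> \<kappa> \<zeta>}"

definition cloning_of :: "'a operad_data \<Rightarrow> 'a cloning_data" where
  "cloning_of = (\<lambda>(G, \<pi>, comp, unit).
    (G,
     \<lambda>n\<in>{1..}. \<lambda>g\<in>carrier (G n). comp 2 n 1 \<one>\<^bsub>G 2\<^esub> g,
     \<lambda>n\<in>{1..}. \<lambda>g\<in>carrier (G n). comp 2 n 2 \<one>\<^bsub>G 2\<^esub> g,
     \<lambda>n\<in>{1..}. \<lambda>j\<in>{1..n}. \<lambda>g\<in>carrier (G n). comp n 2 j g \<one>\<^bsub>G 2\<^esub>,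
     \<pi>))"

definition operad_of :: "'a cloning_data \<Rightarrow> 'a operad_data" where
  "operad_of = (\<lambda>(G, \<iota>, \<zeta>, \<kappa>, \<pi>).
    (G,
     \<pi>,
     \<lambda>n\<in>{1..}. \<lambda>m\<in>{1..}. \<lambda>i\<in>{1..n}. \<lambda>f\<in>carrier (G n). \<lambda>g\<in>carrier (G m).
       kappa_iter \<kappa> n i m f \<otimes>\<^bsub>G (n + m - 1)\<^esub> nu \<iota> \<zeta> m i n g,
     \<one>\<^bsub>G 1\<^esub>))"

text \<open>
  In a general action operad the value of \<open>\<pi> (n + m - 1)\<close> on \<open>comp n m i \<one> h\<close> is prescribed only
  off the block \<open>{i..i+m-1}\<close>.  For \<open>n = 2\<close> and \<open>i = 1, 2\<close> the cloning system axioms \<open>pi_iota\<close> and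
  \<open>pi_zeta\<close> prescribe it on the block as well, by the following condition, which does not follow from
  the axioms of a general action operad (see the example below).
\<close>

definition pi_comp_one :: "'a operad_data \<Rightarrow> bool" where
  "pi_comp_one = (\<lambda>(G, \<pi>, comp, unit).
    \<forall>n\<ge>1. \<forall>m\<ge>1. \<forall>i\<in>{1..n}. \<forall>h\<in>carrier (G m).
      \<pi> (n + m - 1) (comp n m i \<one>\<^bsub>G n\<^esub> h) = sym_comp n m i (\<pi> n \<one>\<^bsub>G n\<^esub>) (\<pi> m h))"

text \<open>
  The example: all groups have order two, the nontrivial element acts as the order reversal, and
  \<open>comp n m i f g = f\<close> unless \<open>n = 1\<close>, when it is the product.  Here the first construction gives
  the trivial map for \<open>\<iota>\<close>, which violates \<open>pi_iota\<close>.
\<close>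

definition flip_group :: "nat \<Rightarrow> bool monoid" where
  "flip_group n = \<lparr>carrier = UNIV, mult = (\<noteq>), one = False\<rparr>"

definition flip_pi :: "nat \<Rightarrow> bool \<Rightarrow> nat \<Rightarrow> nat" where
  "flip_pi n b k = (if b \<and> k \<in> {1..n} then n + 1 - k else k)"

definition flip_comp :: "nat \<Rightarrow> nat \<Rightarrow> nat \<Rightarrow> bool \<Rightarrow> bool \<Rightarrow> bool" where
  "flip_comp = (\<lambda>n\<in>{1..}. \<lambda>m\<in>{1..}. \<lambda>i\<in>{1..n}. \<lambda>f\<in>UNIV. \<lambda>g\<in>UNIV.
    if n = 1 then f \<noteq> g else f)"

lemma flip_comp_apply:
  "n \<ge> 1 \<Longrightarrow> m \<ge> 1 \<Longrightarrow> i \<in> {1..n} \<Longrightarrow> flip_comp n m i f g = (if n = 1 then f \<noteq> g else f)"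
  by (simp add: flip_comp_def)

lemma flip_pi_permutes: "flip_pi n b permutes {1..n}"
proof (rule bij_imp_permutes)
  show "bij_betw (flip_pi n b) {1..n} {1..n}"
    by (rule bij_betwI[where g = "flip_pi n b"]) (auto simp: flip_pi_def)
qed (auto simp: flip_pi_def)

lemma flip_general_action_operad: "general_action_operad flip_group flip_pi flip_comp False"
proof (intro general_action_operad.intro operad_over_sym.intro groups_over_sym.intro
    operad_over_sym_axioms.intro general_action_operad_axioms.intro)
  fix n :: nat assume n: "n \<ge> 1"
  show "group (flip_group n)"
    by (rule groupI) (auto simp: flip_group_def)
  show "flip_pi n \<in> hom (flip_group n) (sym_group n)"
    using flip_pi_permutes
    by (auto simp: hom_def sym_group_def flip_group_def flip_pi_def fun_eq_iff)
next
  show "flip_comp \<in> (\<Pi>\<^sub>E n\<in>{1..}. \<Pi>\<^sub>E m\<in>{1..}. \<Pi>\<^sub>E i\<in>{1..n}.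
      carrier (flip_group n) \<rightarrow>\<^sub>E carrier (flip_group m) \<rightarrow>\<^sub>E carrier (flip_group (n + m - 1)))"
    by (auto simp: flip_comp_def flip_group_def)
next
  fix n m :: nat and g h i k
  assume a: "n \<ge> 1" "m \<ge> 1" "i \<in> {1..n}" and k: "k \<in> {1..n+m-1} - {i..i+m-1}"
  then have "n \<noteq> 1" by auto
  with a have c: "flip_comp n m i g h = g" by (simp add: flip_comp_apply)
  show "sym_comp n m i (flip_pi n g) (flip_pi m h) k = flip_pi (n + m - 1) (flip_comp n m i g h) k"
    unfolding c using a k by (auto simp: sym_comp_def flip_pi_def Let_def)
next
  fix n m :: nat and f f' g g' i
  assume a: "n \<ge> 1" "m \<ge> 1" "i \<in> {1..n}"
  then have "flip_pi n f' i \<in> {1..n}" by (auto simp: flip_pi_def)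
  with a show "flip_comp n m i (f \<otimes>\<^bsub>flip_group n\<^esub> f') (g \<otimes>\<^bsub>flip_group m\<^esub> g') =
      flip_comp n m (flip_pi n f' i) f g \<otimes>\<^bsub>flip_group (n + m - 1)\<^esub> flip_comp n m i f' g'"
    by (auto simp: flip_comp_apply flip_group_def)
next
  fix n m l :: nat and f g h i j
  assume a: "n \<ge> 1" "m \<ge> 1" "l \<ge> 1" "i \<in> {1..n}" "j \<in> {1..n+m-1}" "j < i"
  then have "n \<noteq> 1" "n + m - 1 \<noteq> 1" "n + l - 1 \<noteq> 1" "n + m - 1 \<ge> 1" "n + l - 1 \<ge> 1"
    "j \<in> {1..n}" "i + l - 1 \<in> {1..n+l-1}"
    by auto
  with a show "flip_comp (n + m - 1) l j (flip_comp n m i f g) h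
      = flip_comp (n + l - 1) m (i + l - 1) (flip_comp n l j f h) g"
    by (simp only: flip_comp_apply if_False)
qed (auto simp: flip_comp_apply flip_group_def)

lemma cloning_of_general_action_operad_fails:
  "(flip_group, flip_pi, flip_comp, False) \<in> general_action_operads"
  "cloning_of (flip_group, flip_pi, flip_comp, False) \<notin> operadic_cloning_systems"
proof -
  show "(flip_group, flip_pi, flip_comp, False) \<in> general_action_operads"
    using flip_general_action_operad by (simp add: general_action_operads_def)
  show "cloning_of (flip_group, flip_pi, flip_comp, False) \<notin> operadic_cloning_systems"
  proof
    assume "cloning_of (flip_group, flip_pi, flip_comp, False) \<in> operadic_cloning_systems"
    then obtain \<kappa> \<zeta> where "operadic_cloning_system flip_group flip_pi
        (\<lambda>n\<in>{1..}. \<lambda>g\<in>carrier (flip_group n). flip_comp 2 n 1 \<one>\<^bsub>flip_group 2\<^esub> g) \<kappa> \<zeta>"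
      by (auto simp: cloning_of_def operadic_cloning_systems_def)
    then interpret operadic_cloning_system flip_group flip_pi
        "\<lambda>n\<in>{1..}. \<lambda>g\<in>carrier (flip_group n). flip_comp 2 n 1 \<one>\<^bsub>flip_group 2\<^esub> g" \<kappa> \<zeta> .
    have "flip_pi 3 False 1 = sym_lambda 2 (flip_pi 2 True) 1"
      using pi_iota[of 2 True] by (simp add: flip_group_def flip_comp_apply)
    then show False by (simp add: flip_pi_def sym_lambda_def)
  qed
qed

end

theory Submission
  imports Defs
begin

text \<open>
  In an action operad the interchange law splits every composite as
  \<open>f \<circ>\<^sub>i g = (f \<circ>\<^sub>i e\<^sub>m) (e\<^sub>n \<circ>\<^sub>i g)\<close> and as \<open>(e\<^sub>n \<circ>\<^sub>j g) (f \<circ>\<^sub>i e\<^sub>m)\<close> with \<open>j = \<pi>(f)(i)\<close>.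
  Since \<open>e\<^sub>n \<circ>\<^sub>i e\<^sub>m = e\<^sub>n\<^sub>+\<^sub>m\<^sub>-\<^sub>1\<close>, associativity identifies \<open>f \<circ>\<^sub>i e\<^sub>m\<close> with the iterated cloning map and
  \<open>e\<^sub>n \<circ>\<^sub>i g\<close> with \<open>\<nu>\<close>; equality of the two splittings is (viii), and (ix) comes from the two ways of
  forming \<open>(e\<^sub>2 \<circ>\<^sub>1 g) \<circ>\<^sub>n\<^sub>+\<^sub>1 h\<close>.

  Conversely, (viii) gives the interchange law for \<open>\<kappa>\<^sub>i(m)(f) \<nu>\<^sub>i(n)(g)\<close>.  Associativity reduces to
  commutation rules between the maps \<open>\<kappa>\<close> and \<open>\<nu>\<close>: for nested composites the rule
  \<open>\<kappa>\<^sub>j\<^sub>+\<^sub>s \<kappa>\<^sub>j(m) = \<kappa>\<^sub>j(m + 1)\<close> (\<open>s < m\<close>) absorbs the unknown action of \<open>g\<close> on its own block, and for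
  disjoint ones the two \<open>\<nu>\<close>-factors commute by (ix).
\<close>

section \<open>Coordinates for places, and iterated maps\<close>

lemma place_cases:
  fixes n i :: nat
  assumes "i \<in> {1..n}"
  obtains p q where "i = Suc p" "n = Suc (p + q)"
  using assms that[of "i - 1" "n - i"] by auto

lemma pos_cases:
  fixes m :: nat
  assumes "m \<ge> 1"
  obtains r where "m = Suc r"
  using assms that[of "m - 1"] by auto

lemma iter_up_add: "iter_up F n (r + s) g = iter_up F (n + r) s (iter_up F n r g)"
  by (induction s) (simp_all add: add.assoc)

lemma iter_up_closed:
  assumes "\<And>k x. n \<le> k \<Longrightarrow> x \<in> carrier (G k) \<Longrightarrow> F k x \<in> carrier (G (Suc k))"
    and "g \<in> carrier (G n)"
  shows "iter_up F n r g \<in> carrier (G (n + r))"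
  using assms by (induction r) auto

lemma iter_up_hom:
  assumes "\<And>k. n \<le> k \<Longrightarrow> F k \<in> hom (G k) (G (Suc k))"
  shows "iter_up F n r \<in> hom (G n) (G (n + r))"
proof (induction r)
  case (Suc r)
  then show ?case
    using assms[of "n + r"] by (auto simp: hom_def Pi_iff)
qed (simp add: hom_def)

section \<open>Compositions of permutations\<close>

text \<open>Beyond the block \<tau> fixes its argument, so one shifted formula serves all
  \<open>k \<ge> i\<close>. This is the shape in which \<open>pi_pad\<close> describes the action of
  \<nu>.\<close>

lemma sym_comp_one:
  assumes \<tau>: "\<tau> permutes {1..m}" and "m \<ge> 1" "i \<in> {1..n}"
  shows "sym_comp n m i id \<tau> k = (if i \<le> k then \<tau> (k - (i - 1)) + (i - 1) else k)"
proof -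
  consider "k < i" | "k \<in> {i..i + m - 1}" | "k \<ge> i + m"
    using assms by fastforce
  then show ?thesis
  proof cases
    case 2
    then have "k - (i - 1) = k - i + 1" using assms(3) by auto
    moreover have "k \<in> {1..n + m - 1}" using 2 assms(2,3) by auto
    ultimately show ?thesis using 2 assms(2,3) by (simp add: sym_comp_def add.commute)
  next
    case 3
    then have "\<tau> (k - (i - 1)) = k - (i - 1)"
      using assms by (intro permutes_not_in[OF \<tau>]) auto
    moreover from 3 have "\<not> k \<le> i + m - 1" "i \<le> k - (m - 1)" "i \<le> k" "\<not> k < i"
      using assms by auto
    ultimately show ?thesis
      using assms(2,3) by (simp add: sym_comp_def Let_def)
  qed (simp add: sym_comp_def Let_def)
qed

text \<open>Up to strand j, \<open>sym_clone\<close> compares by \<le> and \<open>sym_comp\<close>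
  by strict inequality; injectivity of \<sigma> makes the two agree off j.\<close>

lemma sym_comp_two:
  assumes \<sigma>: "\<sigma> permutes {1..n}" and j: "j \<in> {1..n}"
  shows "sym_comp n 2 j \<sigma> id = sym_clone n j \<sigma>"
proof
  fix k
  have ne: "\<sigma> x \<noteq> \<sigma> j" if "x \<noteq> j" for x
    using that permutes_inj[OF \<sigma>] by (simp add: inj_eq)
  have "\<sigma> j \<ge> 1"
    using permutes_in_image[OF \<sigma>, of j] j by simp
  consider "k < j" | "k = j" | "k = j + 1" | "k > j + 1" by linarith
  then show "sym_comp n 2 j \<sigma> id k = sym_clone n j \<sigma> k"
  proof cases
    case 1
    then show ?thesis
      using ne[of k] by (simp add: sym_comp_def sym_clone_def Let_def le_less)
  next
    case 2
    then show ?thesis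
      using j \<open>\<sigma> j \<ge> 1\<close> by (simp add: sym_comp_def sym_clone_def)
  next
    case 3
    then show ?thesis
      using j \<open>\<sigma> j \<ge> 1\<close> by (simp add: sym_comp_def sym_clone_def)
  next
    case 4
    then show ?thesis
      using j by (simp add: sym_comp_def sym_clone_def Let_def)
  qed
qed

text \<open>A counting argument: off the block the values of P are those of a block insertion and
  exhaust the complement of the target block, so injectivity leaves only the target block for the
  rest. Since \<tau> is read inside the block only, it may be arbitrary.\<close>

lemma sym_comp_block:
  assumes \<sigma>: "\<sigma> permutes {1..n}" and P: "P permutes {1..n + r}" and j: "j \<in> {1..n}"
    and eq: "\<And>k. k \<in> {1..n + r} - {j..j + r} \<Longrightarrow> P k = sym_comp n (Suc r) j \<sigma> \<tau> k"
    and k: "k \<in> {j..j + r}"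
  shows "P k \<in> {\<sigma> j..\<sigma> j + r}"
proof (rule ccontr)
  assume out: "P k \<notin> {\<sigma> j..\<sigma> j + r}"
  have "P k \<in> {1..n + r}" "\<sigma> j \<in> {1..n}"
    using permutes_in_image[OF P, of k] permutes_in_image[OF \<sigma>, of j] j k by auto
  \<comment> \<open>Collapsing the target block to the single point \<open>\<sigma> j\<close> turns
    \<open>P k\<close> into another value of \<sigma>.\<close>
  define w where "w = (if P k < \<sigma> j then P k else P k - r)"
  have w: "w \<in> {1..n}" "w \<noteq> \<sigma> j" "P k = (if w < \<sigma> j then w else w + r)"
    using out \<open>P k \<in> _\<close> \<open>\<sigma> j \<in> _\<close> by (auto simp: w_def split: if_splits)
  obtain x where x: "x \<in> {1..n}" "\<sigma> x = w"
    using permutes_image[OF \<sigma>] w(1) by (metis imageE)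
  then have "x \<noteq> j" using w(2) by auto
  \<comment> \<open>The place off the block that comes from strand x; P takes the value
    \<open>P k\<close> there as well, against injectivity.\<close>
  define k' where "k' = (if x < j then x else x + r)"
  have k': "k' \<in> {1..n + r} - {j..j + r}"
    using x(1) \<open>x \<noteq> j\<close> j by (auto simp: k'_def)
  have "P k' = P k"
    unfolding eq[OF k'] w(3) x(2)[symmetric]
    using k' \<open>x \<noteq> j\<close> by (auto simp: sym_comp_def k'_def Let_def split: if_splits)
  then have "k' = k" using permutes_inj[OF P] by (simp add: inj_eq)
  with k k' show False by simp
qed

text \<open>The right factor acts first and permutes only the block; the left factor then moves the
  block rigidly. It is the analogue of \<open>comp_split\<close> for permutations.\<close>

lemma sym_comp_decomp:
  assumes \<sigma>: "\<sigma> permutes {1..n}" and \<tau>: "\<tau> permutes {1..m}" and "m \<ge> 1" "i \<in> {1..n}"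
  shows "sym_comp n m i \<sigma> id \<circ> sym_comp n m i id \<tau> = sym_comp n m i \<sigma> \<tau>"
proof
  fix k
  have "\<sigma> i \<ge> 1"
    using permutes_in_image[OF \<sigma>, of i] assms(4) by simp
  show "(sym_comp n m i \<sigma> id \<circ> sym_comp n m i id \<tau>) k = sym_comp n m i \<sigma> \<tau> k"
  proof (cases "k \<in> {i..i + m - 1}")
    case True
    define x where "x = \<tau> (k - i + 1)"
    have "k - i + 1 \<in> {1..m}"
      using True assms(4) by auto
    then have x: "x \<in> {1..m}"
      using permutes_in_image[OF \<tau>] unfolding x_def by blast
    have b: "k \<in> {1..n + m - 1}" "i - 1 + x \<in> {1..n + m - 1}" "i - 1 + x \<in> {i..i + m - 1}"
      "i - 1 + x - i + 1 = x"
      using x assms(3,4) True by auto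
    have "sym_comp n m i id \<tau> k = i - 1 + x"
      using True b(1) by (simp add: sym_comp_def x_def)
    moreover have "sym_comp n m i \<sigma> \<tau> k = \<sigma> i - 1 + x"
      using True b(1) by (simp add: sym_comp_def x_def)
    moreover have "sym_comp n m i \<sigma> id (i - 1 + x) = \<sigma> i - 1 + x"
      using b(2-4) by (simp only: sym_comp_def not_True_eq_False if_False if_True id_apply)
    ultimately show ?thesis by simp
  next
    case False
    then have "sym_comp n m i id \<tau> k = k"
      using assms(3,4) by (auto simp: sym_comp_def Let_def)
    moreover have "sym_comp n m i \<sigma> id k = sym_comp n m i \<sigma> \<tau> k"
      by (simp only: sym_comp_def False if_False)
    ultimately show ?thesis by simp
  qed
qed

section \<open>Groups over the symmetric groups\<close>

context groups_over_sym
begin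

lemma pi_permutes: "n \<ge> 1 \<Longrightarrow> g \<in> carrier (G n) \<Longrightarrow> \<pi> n g permutes {1..n}"
  using hom_in_carrier[OF pi_hom] by (simp add: sym_group_def)

lemma pi_in: "n \<ge> 1 \<Longrightarrow> g \<in> carrier (G n) \<Longrightarrow> i \<in> {1..n} \<Longrightarrow> \<pi> n g i \<in> {1..n}"
  using permutes_in_image[OF pi_permutes] by simp

lemma pi_mult: "n \<ge> 1 \<Longrightarrow> g \<in> carrier (G n) \<Longrightarrow> h \<in> carrier (G n) \<Longrightarrow>
    \<pi> n (g \<otimes>\<^bsub>G n\<^esub> h) = \<pi> n g \<circ> \<pi> n h"
  using hom_mult[OF pi_hom] by (simp add: sym_group_def)

lemma pi_one: "n \<ge> 1 \<Longrightarrow> \<pi> n \<one>\<^bsub>G n\<^esub> = id"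
  using hom_one[OF pi_hom group sym_group_is_group] by (simp add: sym_group_def)

lemma one_closed: "n \<ge> 1 \<Longrightarrow> \<one>\<^bsub>G n\<^esub> \<in> carrier (G n)"
  by (rule monoid.one_closed[OF group.is_monoid[OF group]])

lemma m_closed: "n \<ge> 1 \<Longrightarrow> x \<in> carrier (G n) \<Longrightarrow> y \<in> carrier (G n) \<Longrightarrow>
    x \<otimes>\<^bsub>G n\<^esub> y \<in> carrier (G n)"
  by (rule monoid.m_closed[OF group.is_monoid[OF group]])

lemma l_one: "n \<ge> 1 \<Longrightarrow> x \<in> carrier (G n) \<Longrightarrow> \<one>\<^bsub>G n\<^esub> \<otimes>\<^bsub>G n\<^esub> x = x"
  by (rule monoid.l_one[OF group.is_monoid[OF group]])

lemma r_one: "n \<ge> 1 \<Longrightarrow> x \<in> carrier (G n) \<Longrightarrow> x \<otimes>\<^bsub>G n\<^esub> \<one>\<^bsub>G n\<^esub> = x"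
  by (rule monoid.r_one[OF group.is_monoid[OF group]])

lemma m_assoc: "n \<ge> 1 \<Longrightarrow> x \<in> carrier (G n) \<Longrightarrow> y \<in> carrier (G n) \<Longrightarrow> z \<in> carrier (G n) \<Longrightarrow>
    x \<otimes>\<^bsub>G n\<^esub> y \<otimes>\<^bsub>G n\<^esub> z = x \<otimes>\<^bsub>G n\<^esub> (y \<otimes>\<^bsub>G n\<^esub> z)"
  by (rule monoid.m_assoc[OF group.is_monoid[OF group]])

text \<open>Identifies images of identities under maps that need not be homomorphisms: the twisted
  product rules for composition and cloning give idempotence there, because \<pi> of an identity
  fixes every place.\<close>

lemma idempotent_one: "n \<ge> 1 \<Longrightarrow> x \<in> carrier (G n) \<Longrightarrow> x \<otimes>\<^bsub>G n\<^esub> x = x \<Longrightarrow> x = \<one>\<^bsub>G n\<^esub>"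
  using group.l_cancel_one[OF group, of n x x] by simp

end

section \<open>Cloning systems from operads\<close>

context operad_over_sym
begin

abbreviation e :: "nat \<Rightarrow> 'a" where
  "e n \<equiv> \<one>\<^bsub>G n\<^esub>"

lemma comp_closed:
  "n \<ge> 1 \<Longrightarrow> m \<ge> 1 \<Longrightarrow> i \<in> {1..n} \<Longrightarrow> f \<in> carrier (G n) \<Longrightarrow> g \<in> carrier (G m) \<Longrightarrow>
    comp n m i f g \<in> carrier (G (n + m - 1))"
  by (rule PiE_mem[OF PiE_mem[OF PiE_mem[OF PiE_mem[OF PiE_mem[OF comp_type]]]]]) simp_all

lemma comp_one_one: "n \<ge> 1 \<Longrightarrow> m \<ge> 1 \<Longrightarrow> i \<in> {1..n} \<Longrightarrow> comp n m i (e n) (e m) = e (n + m - 1)"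
  using comp_mult[of n m "e n" "e n" "e m" "e m" i]
  by (intro idempotent_one comp_closed) (auto simp: one_closed l_one pi_one)

lemma comp_split:
  "n \<ge> 1 \<Longrightarrow> m \<ge> 1 \<Longrightarrow> i \<in> {1..n} \<Longrightarrow> f \<in> carrier (G n) \<Longrightarrow> g \<in> carrier (G m) \<Longrightarrow>
    comp n m i f g = comp n m i f (e m) \<otimes>\<^bsub>G (n + m - 1)\<^esub> comp n m i (e n) g"
  using comp_mult[of n m f "e n" "e m" g i] by (simp add: one_closed l_one r_one pi_one)

lemma comp_split':
  "n \<ge> 1 \<Longrightarrow> m \<ge> 1 \<Longrightarrow> i \<in> {1..n} \<Longrightarrow> f \<in> carrier (G n) \<Longrightarrow> g \<in> carrier (G m) \<Longrightarrow>
    comp n m i f g = comp n m (\<pi> n f i) (e n) g \<otimes>\<^bsub>G (n + m - 1)\<^esub> comp n m i f (e m)"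
  using comp_mult[of n m "e n" f g "e m" i] by (simp add: one_closed l_one r_one)

text \<open>Eckmann--Hilton: \<^term>\<open>\<pi> 1\<close> is trivial, so \<open>comp_mult\<close> is an interchange law in arity one.\<close>

lemma unit_eq_one: "unit = e 1"
proof -
  have "\<pi> 1 unit 1 = 1"
    using pi_in[of 1 unit 1] unit_closed by simp
  then have "comp 1 1 1 (unit \<otimes>\<^bsub>G 1\<^esub> e 1) (e 1 \<otimes>\<^bsub>G 1\<^esub> unit) =
      comp 1 1 1 unit (e 1) \<otimes>\<^bsub>G 1\<^esub> comp 1 1 1 (e 1) unit"
    using comp_mult[of 1 1 unit "e 1" "e 1" unit 1]
    by (simp add: unit_closed[simplified] one_closed pi_one)
  then show ?thesis
    using comp_unit[of 1 _ 1] unit_comp[of 1]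
    by (simp add: unit_closed one_closed r_one l_one del: One_nat_def)
qed

text \<open>Each further cloning inserts e_2 at the first strand of the block; associativity moves
  it inside, where it enlarges e_(r+1) to e_(r+2). The map \<kappa> is prescribed on carriers only,
  as suits the extensional maps of \<open>cloning_of\<close>.\<close>

lemma kappa_iter_comp:
  assumes "n \<ge> 1" "i \<in> {1..n}" "g \<in> carrier (G n)"
    and \<kappa>: "\<And>k x. k \<ge> n \<Longrightarrow> x \<in> carrier (G k) \<Longrightarrow> \<kappa> k i x = comp k 2 i x (e 2)"
  shows "iter_up (\<lambda>k. \<kappa> k i) n r g = comp n (Suc r) i g (e (Suc r))"
proof (induction r)
  case 0
  then show ?case using comp_unit assms by (simp add: unit_eq_one)
next
  case (Suc r)
  have "iter_up (\<lambda>k. \<kappa> k i) n (Suc r) g = comp (n + r) 2 i (comp n (Suc r) i g (e (Suc r))) (e 2)"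
    using \<kappa>[of "n + r" "comp n (Suc r) i g (e (Suc r))"] comp_closed[of n "Suc r" i g "e (Suc r)"]
      assms Suc by (simp add: one_closed)
  also have "\<dots> = comp n (Suc (Suc r)) i g (comp (Suc r) 2 1 (e (Suc r)) (e 2))"
    using assoc_inner[of n "Suc r" 2 g "e (Suc r)" "e 2" i i] assms by (simp add: one_closed)
  finally show ?case by (simp add: comp_one_one)
qed

text \<open>Now associativity is used in the other direction: g is pulled out of the inner
  composite, and the identities e_2 and e_(r+1) merge. The iterates of \<zeta> are treated alike,
  with the last place instead of the first.\<close>

lemma iota_iter_comp:
  assumes "n \<ge> 1" "g \<in> carrier (G n)"
    and \<iota>: "\<And>k x. k \<ge> n \<Longrightarrow> x \<in> carrier (G k) \<Longrightarrow> \<iota> k x = comp 2 k 1 (e 2) x"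
  shows "iter_up \<iota> n r g = comp (Suc r) n 1 (e (Suc r)) g"
proof (induction r)
  case 0
  then show ?case using unit_comp assms by (simp add: unit_eq_one)
next
  case (Suc r)
  have "iter_up \<iota> n (Suc r) g = comp 2 (n + r) 1 (e 2) (comp (Suc r) n 1 (e (Suc r)) g)"
    using \<iota>[of "n + r" "comp (Suc r) n 1 (e (Suc r)) g"]
      comp_closed[of "Suc r" n 1 "e (Suc r)" g] assms Suc
    by (simp add: one_closed add.commute)
  also have "\<dots> = comp (Suc (Suc r)) n 1 (comp 2 (Suc r) 1 (e 2) (e (Suc r))) g"
    using assoc_inner[of 2 "Suc r" n "e 2" "e (Suc r)" g 1 1] assms
    by (simp add: one_closed add.commute)
  finally show ?case by (simp add: comp_one_one)
qed

lemma zeta_iter_comp: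
  assumes "n \<ge> 1" "g \<in> carrier (G n)"
    and \<zeta>: "\<And>k x. k \<ge> n \<Longrightarrow> x \<in> carrier (G k) \<Longrightarrow> \<zeta> k x = comp 2 k 2 (e 2) x"
  shows "iter_up \<zeta> n r g = comp (Suc r) n (Suc r) (e (Suc r)) g"
proof (induction r)
  case 0
  then show ?case using unit_comp assms by (simp add: unit_eq_one)
next
  case (Suc r)
  have "iter_up \<zeta> n (Suc r) g = comp 2 (n + r) 2 (e 2) (comp (Suc r) n (Suc r) (e (Suc r)) g)"
    using \<zeta>[of "n + r" "comp (Suc r) n (Suc r) (e (Suc r)) g"]
      comp_closed[of "Suc r" n "Suc r" "e (Suc r)" g] assms Suc
    by (simp add: one_closed add.commute)
  also have "\<dots> = comp (Suc (Suc r)) n (Suc (Suc r)) (comp 2 (Suc r) 2 (e 2) (e (Suc r))) g"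
    using assoc_inner[of 2 "Suc r" n "e 2" "e (Suc r)" g 2 "Suc (Suc r)"] assms
    by (simp add: one_closed add.commute)
  finally show ?case by (simp add: comp_one_one)
qed

text \<open>With \<open>i = p + 1\<close> and \<open>m = p + q + 1\<close>, the \<iota>-part puts g
  at the first place of e_(q+1) and the \<zeta>-part puts the result at the last place of e_(p+1);
  the two identities merge into e_m.\<close>

lemma nu_comp:
  assumes n: "n \<ge> 1" and g: "g \<in> carrier (G n)" and i: "i \<in> {1..m}"
    and \<iota>: "\<And>k x. k \<ge> n \<Longrightarrow> x \<in> carrier (G k) \<Longrightarrow> \<iota> k x = comp 2 k 1 (e 2) x"
    and \<zeta>: "\<And>k x. k \<ge> n \<Longrightarrow> x \<in> carrier (G k) \<Longrightarrow> \<zeta> k x = comp 2 k 2 (e 2) x"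
  shows "nu \<iota> \<zeta> n i m g = comp m n i (e m) g"
proof -
  obtain p where p: "i = Suc p" using i by (cases i) auto
  define q where "q = m - i"
  have m: "m = Suc (p + q)" using i p by (simp add: q_def)
  define x where "x = comp (Suc q) n 1 (e (Suc q)) g"
  have x: "x \<in> carrier (G (n + q))"
    using comp_closed[of "Suc q" n 1 "e (Suc q)" g] n g by (simp add: x_def one_closed add.commute)
  have "nu \<iota> \<zeta> n i m g = iter_up \<zeta> (n + q) p x"
    using iota_iter_comp[OF n g \<iota>, where r = q] by (simp add: nu_def p m x_def)
  also have "\<dots> = comp (Suc p) (n + q) (Suc p) (e (Suc p)) x"
    using x n \<zeta> by (intro zeta_iter_comp) auto
  also have "\<dots> = comp m n i (comp (Suc p) (Suc q) (Suc p) (e (Suc p)) (e (Suc q))) g"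
    using assoc_inner[of "Suc p" "Suc q" n "e (Suc p)" "e (Suc q)" g "Suc p" "Suc p"] n g
    by (simp add: one_closed p m x_def add.commute)
  finally show ?thesis by (simp add: comp_one_one m)
qed

end

section \<open>The cloning system of an operad, and the way back\<close>

text \<open>Recovers an extensional structure map from its values. One application per argument
  proves the equalities of tuples in both round trips.\<close>

lemma restrict_eqI: "f \<in> Pi\<^sub>E A B \<Longrightarrow> (\<And>x. x \<in> A \<Longrightarrow> g x = f x) \<Longrightarrow> restrict g A = f"
  using PiE_restrict[of f A B] restrict_cong[of A A g f] by (simp add: simp_implies_def)

text \<open>Permutations are encoded as functions on all naturals, so stabilisation becomes an
  inclusion of sets.\<close>

lemma sym_lambda_eq: "\<sigma> permutes {1..n} \<Longrightarrow> sym_lambda n \<sigma> = \<sigma>"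
  using permutes_not_in by (fastforce simp: sym_lambda_def)

lemma sym_rho_eq:
  assumes "\<sigma> permutes {1..n}"
  shows "sym_rho n \<sigma> k = (if 2 \<le> k then \<sigma> (k - 1) + 1 else k)"
proof -
  have "\<sigma> (k - 1) = k - 1" if "k > n + 1"
    using that by (intro permutes_not_in[OF assms]) auto
  then show ?thesis by (cases "k > n + 1") (auto simp: sym_rho_def)
qed

lemma (in operad_over_sym) operad_of_cloning_of:
  "operad_of (cloning_of (G, \<pi>, comp, unit)) = (G, \<pi>, comp, unit)"
proof -
  let ?\<iota> = "\<lambda>n\<in>{1..}. \<lambda>g\<in>carrier (G n). comp 2 n 1 (e 2) g"
  let ?\<zeta> = "\<lambda>n\<in>{1..}. \<lambda>g\<in>carrier (G n). comp 2 n 2 (e 2) g"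
  let ?\<kappa> = "\<lambda>n\<in>{1..}. \<lambda>j\<in>{1..n}. \<lambda>g\<in>carrier (G n). comp n 2 j g (e 2)"
  have eq: "kappa_iter ?\<kappa> n i m f \<otimes>\<^bsub>G (n + m - 1)\<^esub> nu ?\<iota> ?\<zeta> m i n g = comp n m i f g"
    if "n \<in> {1..}" "m \<in> {1..}" "i \<in> {1..n}" "f \<in> carrier (G n)" "g \<in> carrier (G m)" for n m i f g
  proof -
    have "kappa_iter ?\<kappa> n i m f = comp n m i f (e m)"
      using kappa_iter_comp[of n i f ?\<kappa> "m - 1"] that by (auto simp: kappa_iter_def)
    moreover have "nu ?\<iota> ?\<zeta> m i n g = comp n m i (e n) g"
      using that by (intro nu_comp) auto
    ultimately show ?thesis
      using comp_split[of n m i f g] that by simp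
  qed
  have "(\<lambda>n\<in>{1..}. \<lambda>m\<in>{1..}. \<lambda>i\<in>{1..n}. \<lambda>f\<in>carrier (G n). \<lambda>g\<in>carrier (G m).
      kappa_iter ?\<kappa> n i m f \<otimes>\<^bsub>G (n + m - 1)\<^esub> nu ?\<iota> ?\<zeta> m i n g) = comp"
    by (rule restrict_eqI[OF comp_type], rule restrict_eqI[OF PiE_mem[OF comp_type]], assumption,
        rule restrict_eqI[OF PiE_mem[OF PiE_mem[OF comp_type]]], assumption, assumption,
        rule restrict_eqI[OF PiE_mem[OF PiE_mem[OF PiE_mem[OF comp_type]]]],
        assumption, assumption, assumption,
        rule restrict_eqI[OF PiE_mem[OF PiE_mem[OF PiE_mem[OF PiE_mem[OF comp_type]]]]],
        assumption, assumption, assumption, assumption, rule eq)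
  then show ?thesis
    by (simp only: operad_of_def cloning_of_def prod.case unit_eq_one)
qed

text \<open>The assumption \<open>pi_comp_one\<close> enters for \<open>pi_iota\<close> and
  \<open>pi_zeta\<close>, which prescribe \<pi> on the block too. Relations between the structure
  maps are associativity with factors e_2; product rules are the interchange law.\<close>

lemma (in general_action_operad) operadic_cloning_system_of_comp:
  assumes pi_comp_one: "\<And>n m i h. \<lbrakk>n \<ge> 1; m \<ge> 1; i \<in> {1..n}; h \<in> carrier (G m)\<rbrakk> \<Longrightarrow>
      \<pi> (n + m - 1) (comp n m i (e n) h) = sym_comp n m i (\<pi> n (e n)) (\<pi> m h)"
  shows "operadic_cloning_system G \<pi>
      (\<lambda>n\<in>{1..}. \<lambda>g\<in>carrier (G n). comp 2 n 1 (e 2) g)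
      (\<lambda>n\<in>{1..}. \<lambda>j\<in>{1..n}. \<lambda>g\<in>carrier (G n). comp n 2 j g (e 2))
      (\<lambda>n\<in>{1..}. \<lambda>g\<in>carrier (G n). comp 2 n 2 (e 2) g)"
    (is "operadic_cloning_system G \<pi> ?\<iota> ?\<kappa> ?\<zeta>")
proof -
  define \<iota> \<zeta> \<kappa> where defs: "\<iota> = ?\<iota>" "\<zeta> = ?\<zeta>" "\<kappa> = ?\<kappa>"
  have \<iota>: "\<iota> n g = comp 2 n 1 (e 2) g" if "n \<ge> 1" "g \<in> carrier (G n)" for n g
    using that by (simp add: defs)
  have \<zeta>: "\<zeta> n g = comp 2 n 2 (e 2) g" if "n \<ge> 1" "g \<in> carrier (G n)" for n g
    using that by (simp add: defs)
  have \<kappa>: "\<kappa> n j g = comp n 2 j g (e 2)" if "n \<ge> 1" "g \<in> carrier (G n)" "j \<in> {1..n}" for n j g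
    using that by (simp add: defs)
  have \<iota>C: "\<iota> n g \<in> carrier (G (n + 1))" if "n \<ge> 1" "g \<in> carrier (G n)" for n g
    using comp_closed[of 2 n 1 "e 2" g] that by (simp add: \<iota> one_closed)
  have \<zeta>C: "\<zeta> n g \<in> carrier (G (n + 1))" if "n \<ge> 1" "g \<in> carrier (G n)" for n g
    using comp_closed[of 2 n 2 "e 2" g] that by (simp add: \<zeta> one_closed)
  have \<kappa>C: "\<kappa> n j g \<in> carrier (G (n + 1))" if "n \<ge> 1" "g \<in> carrier (G n)" "j \<in> {1..n}" for n j g
    using comp_closed[of n 2 j g "e 2"] that by (simp add: \<kappa> one_closed)
  have e2: "e 2 \<in> carrier (G 2)" by (simp add: one_closed)
  have kit: "kappa_iter \<kappa> n i m g = comp n m i g (e m)"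
    if "n \<ge> 1" "m \<ge> 1" "g \<in> carrier (G n)" "i \<in> {1..n}" for n m i g
    using kappa_iter_comp[of n i g \<kappa> "m - 1"] that by (simp add: kappa_iter_def \<kappa>)
  have nuc: "nu \<iota> \<zeta> n i m g = comp m n i (e m) g"
    if "n \<ge> 1" "g \<in> carrier (G n)" "i \<in> {1..m}" for n m i g
    using that by (intro nu_comp) (simp_all add: \<iota> \<zeta>)
  have \<iota>it: "iter_up \<iota> n r g = comp (Suc r) n 1 (e (Suc r)) g"
    if "n \<ge> 1" "g \<in> carrier (G n)" for n r g
    using that by (intro iota_iter_comp) (simp_all add: \<iota>)
  have \<zeta>it: "iter_up \<zeta> n r g = comp (Suc r) n (Suc r) (e (Suc r)) g"
    if "n \<ge> 1" "g \<in> carrier (G n)" for n r g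
    using that by (intro zeta_iter_comp) (simp_all add: \<zeta>)
  \<comment> \<open>As \<pi> of e_2 moves no place, the interchange law is untwisted and makes
    \<iota> and \<zeta> homomorphisms.\<close>
  have comp_one_mult: "comp 2 n i (e 2) (g \<otimes>\<^bsub>G n\<^esub> h) =
      comp 2 n i (e 2) g \<otimes>\<^bsub>G (n + 1)\<^esub> comp 2 n i (e 2) h"
    if "n \<ge> 1" "g \<in> carrier (G n)" "h \<in> carrier (G n)" "i \<in> {1..2}" for n i g h
    using comp_mult[of 2 n "e 2" "e 2" g h i] that e2 by (simp add: l_one pi_one)
  have e22: "comp 2 2 1 (e 2) (e 2) = comp 2 2 2 (e 2) (e 2)"
    by (simp add: comp_one_one)
  have "operadic_cloning_system G \<pi> \<iota> \<kappa> \<zeta>"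
  proof (intro operadic_cloning_system.intro bilateral_cloning_system.intro
      cloning_system.intro cloning_system_axioms.intro bilateral_cloning_system_axioms.intro
      operadic_cloning_system_axioms.intro groups_over_sym_axioms)
    show "\<iota> \<in> (\<Pi>\<^sub>E n\<in>{1..}. carrier (G n) \<rightarrow>\<^sub>E carrier (G (n + 1)))"
      using \<iota>C by (simp add: defs PiE_iff)
    show "\<zeta> \<in> (\<Pi>\<^sub>E n\<in>{1..}. carrier (G n) \<rightarrow>\<^sub>E carrier (G (n + 1)))"
      using \<zeta>C by (simp add: defs PiE_iff)
    show "\<kappa> \<in> (\<Pi>\<^sub>E n\<in>{1..}. \<Pi>\<^sub>E j\<in>{1..n}. carrier (G n) \<rightarrow>\<^sub>E carrier (G (n + 1)))"
      using \<kappa>C by (simp add: defs PiE_iff)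
  next
    fix n :: nat assume n: "n \<ge> 1"
    show "\<iota> n \<in> hom (G n) (G (n + 1))"
      using \<iota>C n by (auto intro!: homI simp: \<iota> comp_one_mult m_closed)
    show "\<zeta> n \<in> hom (G n) (G (n + 1))"
      using \<zeta>C n by (auto intro!: homI simp: \<zeta> comp_one_mult m_closed)
  next
    fix n :: nat and g assume n: "n \<ge> 1" and g: "g \<in> carrier (G n)"
    note perm = pi_permutes[OF n g]
    show "\<pi> (n + 1) (\<iota> n g) = sym_lambda n (\<pi> n g)"
      using pi_comp_one[of 2 n 1 g] n g sym_comp_one[OF perm n, of 1 2]
      by (auto simp: \<iota> pi_one sym_lambda_eq[OF perm] permutes_not_in[OF perm] fun_eq_iff)
    show "\<pi> (n + 1) (\<zeta> n g) = sym_rho n (\<pi> n g)"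
      using pi_comp_one[of 2 n 2 g] n g sym_comp_one[OF perm n, of 2 2]
      by (auto simp: \<zeta> pi_one sym_rho_eq[OF perm] fun_eq_iff)
    \<comment> \<open>This axiom and the next two each compare two ways of inserting g into e_3, at
      its first, second and third place respectively.\<close>
    show "\<iota> (n + 1) (\<iota> n g) = \<kappa> (n + 1) (n + 1) (\<iota> n g)"
      using assoc_right[of 2 n 2 "e 2" g "e 2" 1 "n + 1"] assoc_inner[of 2 2 n "e 2" "e 2" g 1 1]
        n g e2 \<iota>C[OF n g] by (simp add: \<iota> \<kappa> comp_one_one)
    show "\<zeta> (n + 1) (\<iota> n g) = \<iota> (n + 1) (\<zeta> n g)"
      using assoc_inner[of 2 2 n "e 2" "e 2" g 2 2] assoc_inner[of 2 2 n "e 2" "e 2" g 1 2]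
        n g e2 e22 \<iota>C[OF n g] \<zeta>C[OF n g]
      by (simp add: \<iota> \<zeta> flip: numeral_2_eq_2)
    show "\<zeta> (n + 1) (\<zeta> n g) = \<kappa> (n + 1) 1 (\<zeta> n g)"
      using assoc_left[of 2 n 2 "e 2" g "e 2" 2 1] assoc_inner[of 2 2 n "e 2" "e 2" g 2 3]
        n g e2 e22 \<zeta>C[OF n g] by (simp add: \<zeta> \<kappa> flip: numeral_2_eq_2)
  next
    fix n :: nat and g j assume n: "n \<ge> 1" and g: "g \<in> carrier (G n)" and j: "j \<in> {1..n}"
    show "\<pi> (n + 1) (\<kappa> n j g) i = sym_clone n j (\<pi> n g) i" if "i \<in> {1..n+1} - {j, j + 1}" for i
    proof -
      from that have "i \<in> {1..n + 2 - 1} - {j..j + 2 - 1}" by auto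
      from pi_comp_outside[OF n _ g e2 j this] show ?thesis
        using n g j by (simp add: \<kappa> pi_one sym_comp_two[OF pi_permutes[OF n g] j])
    qed
    show "\<iota> (n + 1) (\<kappa> n j g) = \<kappa> (n + 1) j (\<iota> n g)"
      using assoc_inner[of 2 n 2 "e 2" g "e 2" 1 j] n g j e2 \<iota>C[OF n g] \<kappa>C[OF n g j]
      by (simp add: \<iota> \<kappa>)
    show "\<zeta> (n + 1) (\<kappa> n j g) = \<kappa> (n + 1) (j + 1) (\<zeta> n g)"
      using assoc_inner[of 2 n 2 "e 2" g "e 2" 2 "j + 1"] n g j e2 \<zeta>C[OF n g] \<kappa>C[OF n g j]
      by (simp add: \<zeta> \<kappa>)
    show "\<kappa> (n + 1) (j + 1) (\<kappa> n j g) = \<kappa> (n + 1) j (\<kappa> n j g)"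
      using assoc_inner[of n 2 2 g "e 2" "e 2" j "j + 1"] assoc_inner[of n 2 2 g "e 2" "e 2" j j]
        n g j e2 e22 \<kappa>C[OF n g j]
      by (simp add: \<kappa> flip: numeral_2_eq_2)
    show "\<kappa> n j (g \<otimes>\<^bsub>G n\<^esub> h) = \<kappa> n (\<pi> n h j) g \<otimes>\<^bsub>G (n + 1)\<^esub> \<kappa> n j h"
      if h: "h \<in> carrier (G n)" for h
      using comp_mult[of n 2 g h "e 2" "e 2" j] pi_in[OF n h j] n g h j e2
      by (simp add: \<kappa> l_one m_closed)
  next
    fix n :: nat and g l j
    assume n: "n \<ge> 1" and g: "g \<in> carrier (G n)" and lj: "1 \<le> l" "l < j" "j \<le> n"
    show "\<kappa> (n + 1) (j + 1) (\<kappa> n l g) = \<kappa> (n + 1) l (\<kappa> n j g)"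
      using assoc_right[of n 2 2 g "e 2" "e 2" l "j + 1"] n g lj e2 \<kappa>C[OF n g, of l] \<kappa>C[OF n g, of j]
      by (simp add: \<kappa>)
  next
    fix m n :: nat and g h i
    assume a: "m \<ge> 1" "n \<ge> 1" "g \<in> carrier (G n)" "h \<in> carrier (G m)" "i \<in> {1..n}"
    then show "kappa_iter \<kappa> n i m g \<otimes>\<^bsub>G (n + m - 1)\<^esub> nu \<iota> \<zeta> m i n h
        = nu \<iota> \<zeta> m (\<pi> n g i) n h \<otimes>\<^bsub>G (n + m - 1)\<^esub> kappa_iter \<kappa> n i m g"
      using comp_split[of n m i g h] comp_split'[of n m i g h] pi_in[of n g i]
      by (simp add: kit nuc)
  next
    fix m n :: nat and g h
    assume a: "m \<ge> 1" "n \<ge> 1" "g \<in> carrier (G n)" "h \<in> carrier (G m)"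
    \<comment> \<open>These are \<iota>(g) and \<zeta>(h). Inserting h at the free last place of x
      and g at the free first place of y gives the same element; splitting it from either side
      produces the two orders of the product in (ix).\<close>
    define x y where "x = comp 2 n 1 (e 2) g" and "y = comp 2 m 2 (e 2) h"
    have x: "x \<in> carrier (G (Suc n))" and y: "y \<in> carrier (G (Suc m))"
      using \<iota>C[of n g] \<zeta>C[of m h] a by (simp_all add: \<iota> \<zeta> x_def y_def)
    have em: "e m \<in> carrier (G m)" "e n \<in> carrier (G n)" using a by (simp_all add: one_closed)
    have "comp (Suc n) m (Suc n) x h = comp (Suc m) n 1 y g"
      using assoc_right[of 2 n m "e 2" g h 1 "Suc n"] a e2
      by (simp add: x_def y_def flip: numeral_2_eq_2)
    moreover have "comp (Suc n) m (Suc n) x (e m) = comp (Suc m) n 1 (e (Suc m)) g"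
      using assoc_right[of 2 n m "e 2" g "e m" 1 "Suc n"] comp_one_one[of 2 m 2] a e2 em
      by (simp add: x_def flip: numeral_2_eq_2)
    moreover have "comp (Suc m) n 1 y (e n) = comp (Suc n) m (Suc n) (e (Suc n)) h"
      using assoc_left[of 2 m n "e 2" h "e n" 2 1] comp_one_one[of 2 n 1] a e2 em
      by (simp add: y_def flip: numeral_2_eq_2)
    ultimately show "iter_up \<iota> n m g \<otimes>\<^bsub>G (n + m)\<^esub> iter_up \<zeta> m n h
        = iter_up \<zeta> m n h \<otimes>\<^bsub>G (n + m)\<^esub> iter_up \<iota> n m g"
      using comp_split[of "Suc n" m "Suc n" x h] comp_split[of "Suc m" n 1 y g] a x y
      by (simp add: \<iota>it \<zeta>it add.commute)
  qed
  then show ?thesis unfolding defs .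
qed

section \<open>Iterated cloning maps and inclusions\<close>

text \<open>Cloning compares values with \<open>P j\<close>. Values off the block avoid the target
  block, which contains \<open>P j\<close>, so the comparison comes out as with
  \<open>\<sigma> j\<close>, wherever in the block \<open>P j\<close> lies.\<close>

lemma sym_clone_outside:
  assumes \<sigma>: "\<sigma> permutes {1..n}" and j: "j \<in> {1..n}"
    and P: "\<And>k. k \<in> {1..n + r} - {j..j + r} \<Longrightarrow> P k = sym_comp n (Suc r) j \<sigma> \<tau> k"
    and Pj: "P j \<in> {\<sigma> j..\<sigma> j + r}"
    and k: "k \<in> {1..n + Suc r} - {j..j + Suc r}"
  shows "sym_clone (n + r) j P k = sym_comp n (Suc (Suc r)) j \<sigma> \<tau> k"
proof -
  have ne: "\<sigma> x \<noteq> \<sigma> j" if "x \<noteq> j" for x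
    using that permutes_inj[OF \<sigma>] by (simp add: inj_eq)
  show ?thesis
  proof (cases "k < j")
    case True
    with k j have "P k = (if \<sigma> k < \<sigma> j then \<sigma> k else \<sigma> k + r)"
      by (subst P) (auto simp: sym_comp_def Let_def)
    moreover have "sym_clone (n + r) j P k = (if P k \<le> P j then P k else P k + 1)"
      using True k by (simp add: sym_clone_def)
    moreover have "sym_comp n (Suc (Suc r)) j \<sigma> \<tau> k = (if \<sigma> k < \<sigma> j then \<sigma> k else \<sigma> k + Suc r)"
      using True k by (simp add: sym_comp_def Let_def)
    ultimately show ?thesis using Pj ne[of k] True by auto
  next
    case False
    define x where "x = k - Suc r"
    have x: "k = x + Suc r" "j < x" "x \<le> n" using False k by (auto simp: x_def)
    with j have "P (x + r) = (if \<sigma> x < \<sigma> j then \<sigma> x else \<sigma> x + r)"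
      by (subst P) (auto simp: sym_comp_def Let_def)
    moreover have "sym_clone (n + r) j P k = (if P (x + r) < P j then P (x + r) else P (x + r) + 1)"
      using x by (simp add: sym_clone_def)
    moreover have "sym_comp n (Suc (Suc r)) j \<sigma> \<tau> k = (if \<sigma> x < \<sigma> j then \<sigma> x else \<sigma> x + Suc r)"
      using x by (simp add: sym_comp_def Let_def)
    ultimately show ?thesis using Pj ne[of x] x by auto
  qed
qed

text \<open>With the identity inserted, the block carries consecutive values; cloning its first
  strand shifts each value \<open>\<sigma> j + s\<close> one step up and one place on, which
  lengthens the run by one.\<close>

lemma sym_clone_sym_comp:
  assumes \<sigma>: "\<sigma> permutes {1..n}" and j: "j \<in> {1..n}"
  shows "sym_clone (n + r) j (sym_comp n (Suc r) j \<sigma> id) = sym_comp n (Suc (Suc r)) j \<sigma> id"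
proof
  fix k
  let ?P = "sym_comp n (Suc r) j \<sigma> id"
  have "\<sigma> j \<ge> 1"
    using permutes_in_image[OF \<sigma>, of j] j by simp
  then have P: "?P (j + s) = \<sigma> j + s" if "s \<le> r" for s
    using that j by (simp add: sym_comp_def)
  consider "k \<notin> {1..n + Suc r}" | "k \<in> {1..n + Suc r} - {j..j + Suc r}" | "k = j"
    | s where "k = Suc (j + s)" "s \<le> r"
  proof -
    have "\<exists>s\<le>r. k = Suc (j + s)" if "j < k" "k \<le> j + Suc r"
      using that by (intro exI[of _ "k - Suc j"]) auto
    then show ?thesis using that by fastforce
  qed
  then show "sym_clone (n + r) j ?P k = sym_comp n (Suc (Suc r)) j \<sigma> id k"
  proof cases
    case 1
    then show ?thesis by (auto simp: sym_clone_def sym_comp_def)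
  next
    case 2
    then show ?thesis
      using P[of 0] by (intro sym_clone_outside[OF \<sigma> j]) auto
  next
    case 3
    then show ?thesis
      using P[of 0] j \<open>\<sigma> j \<ge> 1\<close> by (simp add: sym_clone_def) (simp add: sym_comp_def)
  next
    case 4
    then show ?thesis
      using P[of 0] P[of s] j \<open>\<sigma> j \<ge> 1\<close> by (simp add: sym_clone_def) (simp add: sym_comp_def)
  qed
qed

section \<open>Iterated duplication of strands\<close>

context cloning_system
begin

text \<open>Counts the added strands, so \<open>kappa_iter\<close> with \<open>m = r + 1\<close>
  loses its truncated subtraction.\<close>

abbreviation dup :: "nat \<Rightarrow> nat \<Rightarrow> nat \<Rightarrow> 'a \<Rightarrow> 'a" where
  "dup n j r \<equiv> iter_up (\<lambda>k. \<kappa> k j) n r"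

lemma iota_closed: "n \<ge> 1 \<Longrightarrow> g \<in> carrier (G n) \<Longrightarrow> \<iota> n g \<in> carrier (G (Suc n))"
  using hom_in_carrier[OF iota_hom] by simp

lemma kappa_closed: "n \<ge> 1 \<Longrightarrow> g \<in> carrier (G n) \<Longrightarrow> 1 \<le> j \<Longrightarrow> j \<le> n \<Longrightarrow> \<kappa> n j g \<in> carrier (G (Suc n))"
  using PiE_mem[OF PiE_mem[OF PiE_mem[OF kappa_type]], of n j g] by simp

lemma iota_iter_closed: "n \<ge> 1 \<Longrightarrow> g \<in> carrier (G n) \<Longrightarrow> iter_up \<iota> n r g \<in> carrier (G (n + r))"
  by (rule iter_up_closed) (auto intro: iota_closed)

lemma dup_closed:
  "n \<ge> 1 \<Longrightarrow> g \<in> carrier (G n) \<Longrightarrow> 1 \<le> j \<Longrightarrow> j \<le> n \<Longrightarrow> dup n j r g \<in> carrier (G (n + r))"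
  by (rule iter_up_closed) (auto intro: kappa_closed)

lemma pi_iota_iter: "n \<ge> 1 \<Longrightarrow> g \<in> carrier (G n) \<Longrightarrow> \<pi> (n + r) (iter_up \<iota> n r g) = \<pi> n g"
proof (induction r)
  case (Suc r)
  then show ?case
    using pi_iota[of "n + r" "iter_up \<iota> n r g"] iota_iter_closed[of n g r]
      sym_lambda_eq[OF pi_permutes[of "n + r" "iter_up \<iota> n r g"]]
    by simp
qed simp

text \<open>Axiom (ii) is silent about the strands j and j + 1, yet the next cloning compares with
  the value at j. The induction hypothesis off the block locates that value through
  \<open>sym_comp_block\<close>, which is all that \<open>sym_clone_outside\<close> asks
  for.\<close>

lemma pi_dup_outside:
  assumes n: "n \<ge> 1" and g: "g \<in> carrier (G n)" and j: "1 \<le> j" "j \<le> n"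
    and k: "k \<in> {1..n + r} - {j..j + r}"
  shows "\<pi> (n + r) (dup n j r g) k = sym_comp n (Suc r) j (\<pi> n g) \<tau> k"
  using k
proof (induction r arbitrary: k)
  case 0
  then show ?case by (auto simp: sym_comp_def Let_def)
next
  case (Suc r)
  have D: "dup n j r g \<in> carrier (G (n + r))"
    using dup_closed n g j by simp
  have "\<pi> (n + r) (dup n j r g) j \<in> {\<pi> n g j..\<pi> n g j + r}"
    using n j by (intro sym_comp_block[OF pi_permutes[OF n g] pi_permutes[OF _ D] _ Suc.IH]) auto
  then have "sym_clone (n + r) j (\<pi> (n + r) (dup n j r g)) k =
      sym_comp n (Suc (Suc r)) j (\<pi> n g) \<tau> k"
    using Suc j by (intro sym_clone_outside[OF pi_permutes[OF n g]]) auto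
  then show ?case
    using pi_kappa_outside[of "n + r" "dup n j r g" j k] D n j Suc.prems by auto
qed

lemma pi_dup_block:
  assumes n: "n \<ge> 1" and g: "g \<in> carrier (G n)" and j: "1 \<le> j" "j \<le> n"
  obtains s where "s \<le> r" "\<pi> (n + r) (dup n j r g) j = \<pi> n g j + s"
proof -
  have "\<pi> (n + r) (dup n j r g) j \<in> {\<pi> n g j..\<pi> n g j + r}"
    using n j dup_closed[OF n g j, of r]
    by (intro sym_comp_block[OF pi_permutes[OF n g] pi_permutes _ pi_dup_outside[OF n g j]]) auto
  then show thesis
    using that[of "\<pi> (n + r) (dup n j r g) j - \<pi> n g j"] by auto
qed

lemma kappa_iota_iter:
  "n \<ge> 1 \<Longrightarrow> g \<in> carrier (G n) \<Longrightarrow> 1 \<le> j \<Longrightarrow> j \<le> n \<Longrightarrow>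
    \<kappa> (n + r) j (iter_up \<iota> n r g) = iter_up \<iota> (Suc n) r (\<kappa> n j g)"
proof (induction r)
  case (Suc r)
  then show ?case
    using iota_kappa[of "n + r" "iter_up \<iota> n r g" j] iota_iter_closed[of n g r] by simp
qed simp

end

section \<open>Adding idle strands on both sides\<close>

context bilateral_cloning_system
begin

text \<open>Here p and q count the idle strands to the left and right of g; they replace the place
  and the arity in \<open>nu\<close>.\<close>

abbreviation pad :: "nat \<Rightarrow> nat \<Rightarrow> nat \<Rightarrow> 'a \<Rightarrow> 'a" where
  "pad n p q g \<equiv> iter_up \<zeta> (n + q) p (iter_up \<iota> n q g)"

lemma nu_pad: "nu \<iota> \<zeta> n (Suc p) (Suc (p + q)) g = pad n p q g"
  by (simp add: nu_def)

lemma zeta_closed: "n \<ge> 1 \<Longrightarrow> g \<in> carrier (G n) \<Longrightarrow> \<zeta> n g \<in> carrier (G (Suc n))"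
  using hom_in_carrier[OF zeta_hom] by simp

lemma zeta_iter_closed: "n \<ge> 1 \<Longrightarrow> g \<in> carrier (G n) \<Longrightarrow> iter_up \<zeta> n r g \<in> carrier (G (n + r))"
  by (rule iter_up_closed) (auto intro: zeta_closed)

lemma zeta_iter_hom: "n \<ge> 1 \<Longrightarrow> iter_up \<zeta> n r \<in> hom (G n) (G (n + r))"
  using zeta_hom by (intro iter_up_hom) simp

lemma iota_iter_hom: "n \<ge> 1 \<Longrightarrow> iter_up \<iota> n r \<in> hom (G n) (G (n + r))"
  using iota_hom by (intro iter_up_hom) simp

lemma pad_hom: "n \<ge> 1 \<Longrightarrow> pad n p q \<in> hom (G n) (G (n + q + p))"
  using hom_compose[OF iota_iter_hom[of n q] zeta_iter_hom[of "n + q" p]] by (simp add: comp_def)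

lemma pad_closed: "n \<ge> 1 \<Longrightarrow> g \<in> carrier (G n) \<Longrightarrow> pad n p q g \<in> carrier (G (n + q + p))"
  using hom_in_carrier[OF pad_hom] .

lemma pad_mult: "n \<ge> 1 \<Longrightarrow> g \<in> carrier (G n) \<Longrightarrow> h \<in> carrier (G n) \<Longrightarrow>
    pad n p q (g \<otimes>\<^bsub>G n\<^esub> h) = pad n p q g \<otimes>\<^bsub>G (n + q + p)\<^esub> pad n p q h"
  using hom_mult[OF pad_hom] .

lemma pad_one: "n \<ge> 1 \<Longrightarrow> pad n p q \<one>\<^bsub>G n\<^esub> = \<one>\<^bsub>G (n + q + p)\<^esub>"
  using hom_one[OF pad_hom group group] by simp

lemma pi_pad:
  assumes "n \<ge> 1" "g \<in> carrier (G n)"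
  shows "\<pi> (n + q + p) (pad n p q g) = (\<lambda>k. if p < k then \<pi> n g (k - p) + p else k)"
proof (induction p)
  case 0
  \<comment> \<open>The formula excludes \<open>k = 0\<close> from the shifted range, so the
    unpadded case needs 0 to be fixed.\<close>
  have "\<pi> n g 0 = 0"
    by (intro permutes_not_in[OF pi_permutes[OF assms]]) simp
  then show ?case
    using pi_iota_iter[OF assms] by (auto simp: fun_eq_iff)
next
  case (Suc p)
  let ?x = "pad n p q g"
  have x: "?x \<in> carrier (G (n + q + p))" "n + q + p \<ge> 1"
    using pad_closed assms by auto
  have "\<pi> (n + q + Suc p) (pad n (Suc p) q g) = sym_rho (n + q + p) (\<pi> (n + q + p) ?x)"
    using pi_zeta[OF x(2,1)] by simp
  also have "\<dots> = (\<lambda>k. if Suc p < k then \<pi> n g (k - Suc p) + Suc p else k)"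
    using sym_rho_eq[OF pi_permutes[OF x(2,1)]] by (auto simp: fun_eq_iff Suc)
  finally show ?case .
qed

lemma zeta_iota_iter:
  "n \<ge> 1 \<Longrightarrow> g \<in> carrier (G n) \<Longrightarrow> \<zeta> (n + r) (iter_up \<iota> n r g) = iter_up \<iota> (Suc n) r (\<zeta> n g)"
proof (induction r)
  case (Suc r)
  then show ?case
    using zeta_iota[of "n + r" "iter_up \<iota> n r g"] iota_iter_closed[of n g r] by simp
qed simp

lemma pad_alt:
  "n \<ge> 1 \<Longrightarrow> g \<in> carrier (G n) \<Longrightarrow> pad n p q g = iter_up \<iota> (n + p) q (iter_up \<zeta> n p g)"
proof (induction p)
  case (Suc p)
  then show ?case
    using zeta_iota_iter[of "n + p" "iter_up \<zeta> n p g" q] zeta_iter_closed[of n g p]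
    by (simp add: ac_simps)
qed simp

text \<open>By (vi) the inner \<zeta> maps move past the outer \<iota> maps; like iterates then
  join.\<close>

lemma pad_pad:
  assumes "n \<ge> 1" "g \<in> carrier (G n)"
  shows "pad (n + q + p) p' q' (pad n p q g) = pad n (p + p') (q + q') g"
proof -
  let ?x = "iter_up \<iota> n q g"
  have x: "?x \<in> carrier (G (n + q))" using iota_iter_closed assms by simp
  have "pad (n + q + p) p' q' (pad n p q g) =
      iter_up \<zeta> (n + q + p + q') p' (iter_up \<zeta> (n + q + q') p (iter_up \<iota> (n + q) q' ?x))"
    using pad_alt[OF _ x, where p = p and q = q'] assms by simp
  then show ?thesis
    using iter_up_add[of \<zeta> "n + (q + q')" p p'] by (simp add: iter_up_add ac_simps)
qed

lemma kappa_zeta_iter: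
  "n \<ge> 1 \<Longrightarrow> g \<in> carrier (G n) \<Longrightarrow> 1 \<le> j \<Longrightarrow> j \<le> n \<Longrightarrow>
    \<kappa> (n + p) (j + p) (iter_up \<zeta> n p g) = iter_up \<zeta> (Suc n) p (\<kappa> n j g)"
proof (induction p)
  case (Suc p)
  then show ?case
    using zeta_kappa[of "n + p" "iter_up \<zeta> n p g" "j + p"] zeta_iter_closed[of n g p] by simp
qed simp

text \<open>Cloning an idle strand yields one more idle strand: (vii') settles the first strand and
  (iii') reduces strand j to strand j - 1. On the right, (vii) and (iii) do the same.\<close>

lemma kappa_zeta_iter_low:
  "n \<ge> 1 \<Longrightarrow> g \<in> carrier (G n) \<Longrightarrow> 1 \<le> j \<Longrightarrow> j \<le> p \<Longrightarrow>
    \<kappa> (n + p) j (iter_up \<zeta> n p g) = iter_up \<zeta> n (Suc p) g"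
proof (induction p arbitrary: j)
  case (Suc p)
  let ?x = "iter_up \<zeta> n p g"
  have x: "?x \<in> carrier (G (n + p))" using zeta_iter_closed Suc by simp
  show ?case
  proof (cases "j = 1")
    case True
    then show ?thesis using zeta_zeta[OF _ x] Suc.prems by simp
  next
    case False
    then obtain j' where "j = Suc j'" "1 \<le> j'" "j' \<le> p"
      using Suc.prems by (cases j) auto
    then show ?thesis
      using zeta_kappa[OF _ x, of j'] Suc by simp
  qed
qed simp

lemma kappa_iota_iter_high:
  "n \<ge> 1 \<Longrightarrow> g \<in> carrier (G n) \<Longrightarrow> n < j \<Longrightarrow> j \<le> n + q \<Longrightarrow>
    \<kappa> (n + q) j (iter_up \<iota> n q g) = iter_up \<iota> n (Suc q) g"
proof (induction q)
  case (Suc q)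
  let ?x = "iter_up \<iota> n q g"
  have x: "?x \<in> carrier (G (n + q))" using iota_iter_closed Suc by simp
  show ?case
  proof (cases "j = Suc (n + q)")
    case True
    then show ?thesis using iota_iota[OF _ x] Suc.prems by simp
  next
    case False
    then show ?thesis
      using iota_kappa[OF _ x, of j] Suc by simp
  qed
qed simp

text \<open>This rule and the next two cover the possible positions of a cloned strand: within g,
  among the idle strands on the left, or among those on the right.\<close>

lemma dup_pad_inner:
  assumes "n \<ge> 1" "g \<in> carrier (G n)" "1 \<le> j" "j \<le> n"
  shows "dup (n + q + p) (j + p) r (pad n p q g) = pad (n + r) p q (dup n j r g)"
proof (induction r)
  case (Suc r)
  let ?x = "dup n j r g"
  have x: "?x \<in> carrier (G (n + r))" using dup_closed assms by simp
  have "\<kappa> (n + r + q + p) (j + p) (pad (n + r) p q ?x) = pad (Suc (n + r)) p q (\<kappa> (n + r) j ?x)"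
    using kappa_zeta_iter[OF _ iota_iter_closed[OF _ x, of q], of j p]
      kappa_iota_iter[OF _ x, of j q] assms by simp
  with Suc show ?case by (simp add: ac_simps)
qed simp

lemma dup_pad_left:
  assumes "n \<ge> 1" "g \<in> carrier (G n)" "1 \<le> j" "j \<le> p"
  shows "dup (n + q + p) j r (pad n p q g) = pad n (p + r) q g"
proof (induction r)
  case (Suc r)
  have "\<kappa> (n + q + (p + r)) j (pad n (p + r) q g) = pad n (Suc (p + r)) q g"
    using assms by (intro kappa_zeta_iter_low iota_iter_closed) auto
  with Suc show ?case by (simp add: ac_simps)
qed simp

lemma dup_pad_right:
  assumes "n \<ge> 1" "g \<in> carrier (G n)" "n < j" "j \<le> n + q"
  shows "dup (n + q + p) (j + p) r (pad n p q g) = pad n p (q + r) g"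
proof (induction r)
  case (Suc r)
  have "\<kappa> (n + (q + r) + p) (j + p) (pad n p (q + r) g) = pad n p (Suc (q + r)) g"
    using kappa_zeta_iter[OF _ iota_iter_closed[of n g "q + r"], of j p]
      kappa_iota_iter_high[of n g j "q + r"] assms by simp
  with Suc show ?case by (simp add: ac_simps)
qed simp

lemma kappa_kappa_le:
  assumes "n \<ge> 1" "g \<in> carrier (G n)" "1 \<le> l" "l \<le> j" "j \<le> n"
  shows "\<kappa> (Suc n) (Suc j) (\<kappa> n l g) = \<kappa> (Suc n) l (\<kappa> n j g)"
  using kappa_kappa[of n g l j] kappa_kappa_same[of n g j] assms by (cases "l = j") auto

text \<open>The relation \<open>\<kappa>\<^sub>j\<^sub>+\<^sub>t\<^sub>+\<^sub>1 \<kappa>\<^sub>j =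
  \<kappa>\<^sub>j \<kappa>\<^sub>j\<^sub>+\<^sub>t\<close>, from (iv) and (iv+), passes to strand j
  + t after one cloning fewer, where induction applies.\<close>

lemma kappa_dup:
  assumes n: "n \<ge> 1" and g: "g \<in> carrier (G n)" and j: "1 \<le> j" "j \<le> n"
  shows "s \<le> r \<Longrightarrow> \<kappa> (n + r) (j + s) (dup n j r g) = dup n j (Suc r) g"
proof (induction r arbitrary: s)
  case (Suc r)
  show ?case
  proof (cases s)
    case (Suc t)
    then show ?thesis
      using kappa_kappa_le[of "n + r" "dup n j r g" j "j + t"] dup_closed[OF n g j] n j
        Suc.IH[of t] \<open>s \<le> Suc r\<close> by simp
  qed simp
qed simp

lemma dup_dup:
  assumes "n \<ge> 1" "g \<in> carrier (G n)" "1 \<le> j" "j \<le> n" "s \<le> r"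
  shows "dup (n + r) (j + s) t (dup n j r g) = dup n j (r + t) g"
proof (induction t)
  case (Suc t)
  then show ?case
    using kappa_dup[of n g j s "r + t"] assms by (simp add: ac_simps)
qed simp

lemma kappa_dup_commute:
  assumes n: "n \<ge> 1" and g: "g \<in> carrier (G n)" and j: "1 \<le> j" "j < k" "k \<le> n"
  shows "\<kappa> (n + r) (k + r) (dup n j r g) = dup (Suc n) j r (\<kappa> n k g)"
proof (induction r)
  case (Suc r)
  then show ?case
    using kappa_kappa[of "n + r" "dup n j r g" j "k + r"] dup_closed[OF n g, of j r] n j by simp
qed simp

lemma dup_commute:
  assumes n: "n \<ge> 1" and g: "g \<in> carrier (G n)" and j: "1 \<le> j" "j < k" "k \<le> n"
  shows "dup (n + r) (k + r) t (dup n j r g) = dup (n + t) j r (dup n k t g)"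
proof (induction t)
  case (Suc t)
  then show ?case
    using kappa_dup_commute[of "n + t" "dup n k t g" j k r] dup_closed[OF n g, of k t] n j
    by (simp add: ac_simps)
qed simp

text \<open>Only the image of the block \<open>{j..j + r}\<close> under \<open>\<pi> (n + r) (dup n j r h)\<close> is known, not that of
  \<open>j\<close>; by \<open>kappa_dup\<close> this suffices.\<close>

lemma dup_mult:
  assumes n: "n \<ge> 1" and g: "g \<in> carrier (G n)" and h: "h \<in> carrier (G n)" and j: "1 \<le> j" "j \<le> n"
  shows "dup n j r (g \<otimes>\<^bsub>G n\<^esub> h) = dup n (\<pi> n h j) r g \<otimes>\<^bsub>G (n + r)\<^esub> dup n j r h"
proof (induction r)
  case (Suc r)
  have i: "1 \<le> \<pi> n h j" "\<pi> n h j \<le> n" using pi_in[OF n h, of j] j by auto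
  obtain s where "s \<le> r" "\<pi> (n + r) (dup n j r h) j = \<pi> n h j + s"
    using pi_dup_block[OF n h j] .
  then show ?case
    using kappa_mult[of "n + r" "dup n (\<pi> n h j) r g" "dup n j r h" j] Suc n i j
      kappa_dup[OF n g i, of s r] dup_closed[OF n g i] dup_closed[OF n h j] by simp
qed simp

lemma dup_one: "n \<ge> 1 \<Longrightarrow> 1 \<le> j \<Longrightarrow> j \<le> n \<Longrightarrow> dup n j r \<one>\<^bsub>G n\<^esub> = \<one>\<^bsub>G (n + r)\<^esub>"
  using dup_mult[of n "\<one>\<^bsub>G n\<^esub>" "\<one>\<^bsub>G n\<^esub>" j r]
  by (intro idempotent_one) (auto simp: one_closed dup_closed pi_one l_one)

end

section \<open>Operads from cloning systems\<close>

context operadic_cloning_system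
begin

text \<open>\<open>ins p q r f g\<close> is \<open>f \<circ>\<^sub>i g\<close> for \<open>f\<close> of arity \<open>n = p + q + 1\<close>, \<open>g\<close> of arity \<open>m = r + 1\<close>
  and \<open>i = p + 1\<close>; in these parameters no arity involves a truncated subtraction.\<close>

definition ins :: "nat \<Rightarrow> nat \<Rightarrow> nat \<Rightarrow> 'a \<Rightarrow> 'a \<Rightarrow> 'a" where
  "ins p q r f g = dup (Suc (p + q)) (Suc p) r f \<otimes>\<^bsub>G (Suc (p + q + r))\<^esub> pad (Suc r) p q g"

lemma ins_dup_closed:
  "f \<in> carrier (G (Suc (p + q))) \<Longrightarrow> dup (Suc (p + q)) (Suc p) r f \<in> carrier (G (Suc (p + q + r)))"
  using dup_closed[of "Suc (p + q)" f "Suc p" r] by simp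

lemma ins_pad_closed:
  "g \<in> carrier (G (Suc r)) \<Longrightarrow> pad (Suc r) p q g \<in> carrier (G (Suc (p + q + r)))"
  using pad_closed[of "Suc r" g q p] by (simp add: ac_simps)

lemma ins_closed:
  "f \<in> carrier (G (Suc (p + q))) \<Longrightarrow> g \<in> carrier (G (Suc r)) \<Longrightarrow>
    ins p q r f g \<in> carrier (G (Suc (p + q + r)))"
  unfolding ins_def by (intro m_closed ins_dup_closed ins_pad_closed) auto

lemma pi_ins_pad:
  "g \<in> carrier (G (Suc r)) \<Longrightarrow> \<pi> (Suc (p + q + r)) (pad (Suc r) p q g) =
    (\<lambda>k. if p < k then \<pi> (Suc r) g (k - p) + p else k)"
  using pi_pad[of "Suc r" g q p] by (simp add: ac_simps)

text \<open>The left factor of a product is cloned at the place to which the right factor carries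
  strand j; the conditional is that place for a padded g.\<close>

lemma dup_ins:
  assumes f: "f \<in> carrier (G (Suc (p + q)))" and g: "g \<in> carrier (G (Suc r))"
    and j: "1 \<le> j" "j \<le> Suc (p + q + r)"
  shows "dup (Suc (p + q + r)) j t (ins p q r f g) =
      dup (Suc (p + q + r)) (if p < j then \<pi> (Suc r) g (j - p) + p else j) t
        (dup (Suc (p + q)) (Suc p) r f) \<otimes>\<^bsub>G (Suc (p + q + r + t))\<^esub>
      dup (Suc (p + q + r)) j t (pad (Suc r) p q g)"
  unfolding ins_def
  using dup_mult[OF _ ins_dup_closed[OF f, of r] ins_pad_closed[OF g, of q p] j, of t]
  unfolding pi_ins_pad[OF g] by simp

lemma ins_mult:
  assumes f: "f \<in> carrier (G (Suc (p + q)))" "f' \<in> carrier (G (Suc (p + q)))"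
    and g: "g \<in> carrier (G (Suc r))" "g' \<in> carrier (G (Suc r))"
    and p': "\<pi> (Suc (p + q)) f' (Suc p) = Suc p'" "p' + q' = p + q"
  shows "ins p q r (f \<otimes>\<^bsub>G (Suc (p + q))\<^esub> f') (g \<otimes>\<^bsub>G (Suc r)\<^esub> g') =
      ins p' q' r f g \<otimes>\<^bsub>G (Suc (p + q + r))\<^esub> ins p q r f' g'"
proof -
  define N where "N = Suc (p + q + r)"
  define A B C D E where "A = dup (Suc (p + q)) (Suc p') r f" and "B = dup (Suc (p + q)) (Suc p) r f'"
    and "C = pad (Suc r) p q g" and "D = pad (Suc r) p q g'" and "E = pad (Suc r) p' q' g"
  have closed: "A \<in> carrier (G N)" "B \<in> carrier (G N)" "C \<in> carrier (G N)" "D \<in> carrier (G N)"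
    "E \<in> carrier (G N)"
    using ins_dup_closed[of f p' q' r] ins_dup_closed[of f' p q r] ins_pad_closed[OF g(1), of q p]
      ins_pad_closed[OF g(2), of q p] ins_pad_closed[OF g(1), of q' p'] f p'(2)
    by (simp_all add: N_def A_def B_def C_def D_def E_def)
  have N: "N \<ge> 1" by (simp add: N_def)
  \<comment> \<open>Axiom (viii): passing the cloned f' moves the inserted g from place p + 1 to its
    image p' + 1.\<close>
  have comm: "B \<otimes>\<^bsub>G N\<^esub> C = E \<otimes>\<^bsub>G N\<^esub> B"
    using kappa_nu[of "Suc r" "Suc (p + q)" f' g "Suc p"] f g p'
      nu_pad[of "Suc r" p q g] nu_pad[of "Suc r" p' q' g]
    by (simp add: kappa_iter_def N_def B_def C_def E_def)
  have "ins p q r (f \<otimes>\<^bsub>G (Suc (p + q))\<^esub> f') (g \<otimes>\<^bsub>G (Suc r)\<^esub> g') =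
      (A \<otimes>\<^bsub>G N\<^esub> B) \<otimes>\<^bsub>G N\<^esub> (C \<otimes>\<^bsub>G N\<^esub> D)"
    using dup_mult[of "Suc (p + q)" f f' "Suc p" r] pad_mult[of "Suc r" g g' q p] f g p'(1)
    by (simp add: ins_def N_def A_def B_def C_def D_def ac_simps)
  also have "\<dots> = A \<otimes>\<^bsub>G N\<^esub> (B \<otimes>\<^bsub>G N\<^esub> C) \<otimes>\<^bsub>G N\<^esub> D"
    using closed N by (simp add: m_assoc m_closed)
  also have "\<dots> = (A \<otimes>\<^bsub>G N\<^esub> E) \<otimes>\<^bsub>G N\<^esub> (B \<otimes>\<^bsub>G N\<^esub> D)"
    unfolding comm using closed N by (simp add: m_assoc m_closed)
  finally show ?thesis
    by (simp add: ins_def N_def A_def B_def D_def E_def p'(2))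
qed

text \<open>Both sides are the product A B C of the cloned f, the padded clone of g and the padded
  h, bracketed differently.\<close>

lemma ins_ins_inner:
  assumes f: "f \<in> carrier (G (Suc (p + q)))" and g: "g \<in> carrier (G (Suc (s + u)))"
    and h: "h \<in> carrier (G (Suc t))"
  shows "ins (p + s) (q + u) t (ins p q (s + u) f g) h = ins p q (s + u + t) f (ins s u t g h)"
proof -
  define N where "N = Suc (p + q + (s + u) + t)"
  \<comment> \<open>The strand to be cloned in f lies i places into the block of g. Only
    \<open>i \<le> s + u\<close> matters, because \<open>dup_dup\<close> forgets the position within
    a block.\<close>
  define i where "i = \<pi> (Suc (s + u)) g (Suc s) - 1"
  have "\<pi> (Suc (s + u)) g (Suc s) \<in> {1..Suc (s + u)}"
    by (rule pi_in[OF _ g]) auto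
  then have i: "\<pi> (Suc (s + u)) g (Suc s) = Suc i" "i \<le> s + u"
    by (auto simp: i_def)
  define A B C where "A = dup (Suc (p + q)) (Suc p) (s + u + t) f"
    and "B = pad (Suc (s + u + t)) p q (dup (Suc (s + u)) (Suc s) t g)"
    and "C = pad (Suc (s + u + t)) p q (pad (Suc t) s u h)"
  have closed: "A \<in> carrier (G N)" "B \<in> carrier (G N)" "C \<in> carrier (G N)"
    using ins_dup_closed[OF f, of "s + u + t"] ins_pad_closed[OF ins_dup_closed[OF g, of t], of q p]
      ins_pad_closed[OF ins_pad_closed[OF h, of u s], of q p]
    by (simp_all add: N_def A_def B_def C_def ac_simps)
  have "dup (Suc (p + q + (s + u))) (Suc (p + s)) t (ins p q (s + u) f g) = A \<otimes>\<^bsub>G N\<^esub> B"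
    using dup_ins[OF f g, of "Suc (p + s)" t]
      dup_dup[of "Suc (p + q)" f "Suc p" i "s + u" t]
      dup_pad_inner[of "Suc (s + u)" g "Suc s" p q t] f g i
    by (simp add: A_def B_def N_def ac_simps)
  moreover have "pad (Suc t) (p + s) (q + u) h = C"
    using pad_pad[of "Suc t" h u s q p] h by (simp add: C_def ac_simps)
  ultimately have "ins (p + s) (q + u) t (ins p q (s + u) f g) h = (A \<otimes>\<^bsub>G N\<^esub> B) \<otimes>\<^bsub>G N\<^esub> C"
    by (simp add: ins_def[of "p + s"] N_def ac_simps)
  also have "\<dots> = A \<otimes>\<^bsub>G N\<^esub> (B \<otimes>\<^bsub>G N\<^esub> C)"
    using closed by (intro m_assoc) (auto simp: N_def)
  also have "B \<otimes>\<^bsub>G N\<^esub> C = pad (Suc (s + u + t)) p q (ins s u t g h)"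
    using pad_mult[OF _ ins_dup_closed[OF g, of t] ins_pad_closed[OF h, of u s], of q p]
    by (simp add: ins_def B_def C_def N_def ac_simps)
  finally show ?thesis
    by (simp add: ins_def[of p] A_def N_def ac_simps)
qed

text \<open>The gap of d strands is absorbed into g and the q strands on the right into h, after
  which (ix) applies; the common p strands on the left are restored by a homomorphism.\<close>

lemma pad_commute:
  assumes g: "g \<in> carrier (G n)" "n \<ge> 1" and h: "h \<in> carrier (G m)" "m \<ge> 1"
  shows "pad n p (d + m + q) g \<otimes>\<^bsub>G (n + d + m + q + p)\<^esub> pad m (n + d + p) q h =
      pad m (n + d + p) q h \<otimes>\<^bsub>G (n + d + m + q + p)\<^esub> pad n p (d + m + q) g"
proof -
  define N where "N = n + d + (m + q)"
  define x y where "x = iter_up \<iota> (n + d) (m + q) (iter_up \<iota> n d g)"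
    and "y = iter_up \<zeta> (m + q) (n + d) (iter_up \<iota> m q h)"
  have closed: "x \<in> carrier (G N)" "y \<in> carrier (G N)"
    using iota_iter_closed[OF _ iota_iter_closed[of n g d], of "m + q"]
      zeta_iter_closed[OF _ iota_iter_closed[of m h q], of "n + d"] g h
    by (simp_all add: N_def x_def y_def ac_simps)
  have "x \<otimes>\<^bsub>G N\<^esub> y = y \<otimes>\<^bsub>G N\<^esub> x"
    using iota_zeta_commute[of "m + q" "n + d" "iter_up \<iota> n d g" "iter_up \<iota> m q h"]
      iota_iter_closed g h by (simp add: x_def y_def N_def)
  moreover have "pad n p (d + m + q) g = iter_up \<zeta> N p x"
    using iter_up_add[of \<iota> n d "m + q" g] by (simp add: x_def N_def ac_simps)
  moreover have "pad m (n + d + p) q h = iter_up \<zeta> N p y"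
    using iter_up_add[of \<zeta> "m + q" "n + d" p] by (simp add: y_def N_def ac_simps)
  moreover have "n + d + m + q + p = N + p" "N \<ge> 1"
    using g by (auto simp: N_def)
  ultimately show ?thesis
    using hom_mult[OF zeta_iter_hom[of N p]] closed by metis
qed

text \<open>Two places of f with d strands between them. A is f cloned at both, B and C are the
  padded g and h; the two orders of insertion give A B C and A C B.\<close>

lemma ins_ins_outer:
  assumes f: "f \<in> carrier (G (Suc (Suc (p + d + q))))" and g: "g \<in> carrier (G (Suc r))"
    and h: "h \<in> carrier (G (Suc t))"
  shows "ins p (Suc d + q + r) t (ins (p + Suc d) q r f g) h =
      ins (p + Suc d + t) q r (ins p (Suc d + q) t f h) g"
proof -
  define n where "n = Suc (Suc (p + d + q))"
  define N where "N = n + r + t"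
  define a b where "a = Suc p" and "b = Suc (Suc (p + d))"
  define A B C where "A = dup (n + r) a t (dup n b r f)"
    and "B = pad (Suc r) (Suc (p + d) + t) q g"
    and "C = pad (Suc t) p (Suc d + q + r) h"
  have f': "f \<in> carrier (G (Suc (p + Suc d + q)))" "f \<in> carrier (G (Suc (p + (Suc d + q))))"
    using f by (simp_all add: ac_simps)
  have closed: "A \<in> carrier (G N)" "B \<in> carrier (G N)" "C \<in> carrier (G N)"
    using dup_closed[of "n + r" "dup n b r f" a t] dup_closed[of n f b r]
      ins_pad_closed[OF g, of q "Suc (p + d) + t"] ins_pad_closed[OF h, of "Suc d + q + r" p] f
    by (simp_all add: N_def n_def a_def b_def A_def B_def C_def ac_simps)
  have A: "A = dup (n + t) (b + t) r (dup n a t f)"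
    unfolding A_def using f by (intro dup_commute[symmetric]) (auto simp: n_def a_def b_def)
  have "dup (n + r) a t (ins (p + Suc d) q r f g) = A \<otimes>\<^bsub>G N\<^esub> B"
    using dup_ins[OF f'(1) g, of a t] dup_pad_left[of "Suc r" g a "Suc (p + d)" q t] g
    by (simp add: A_def B_def N_def n_def a_def b_def ac_simps)
  then have 1: "ins p (Suc d + q + r) t (ins (p + Suc d) q r f g) h = (A \<otimes>\<^bsub>G N\<^esub> B) \<otimes>\<^bsub>G N\<^esub> C"
    by (simp add: ins_def[of p] C_def N_def n_def a_def ac_simps)
  \<comment> \<open>The second place lies to the right of the strands of h, so h does not move
    it.\<close>
  have fixed: "\<pi> (Suc t) h (Suc (Suc d) + t) = Suc (Suc d) + t"
    by (intro permutes_not_in[OF pi_permutes[OF _ h]]) auto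
  have "dup (n + t) (b + t) r (ins p (Suc d + q) t f h) = A \<otimes>\<^bsub>G N\<^esub> C"
    using dup_ins[OF f'(2) h, of "b + t" r]
      dup_pad_right[of "Suc t" h "Suc (Suc d) + t" "Suc d + q" p r] h fixed
    unfolding A by (simp add: C_def N_def n_def a_def b_def ac_simps)
  then have 2: "ins (p + Suc d + t) q r (ins p (Suc d + q) t f h) g = (A \<otimes>\<^bsub>G N\<^esub> C) \<otimes>\<^bsub>G N\<^esub> B"
    unfolding ins_def[of "p + Suc d + t"] by (simp add: B_def N_def n_def b_def ac_simps)
  have "C \<otimes>\<^bsub>G N\<^esub> B = B \<otimes>\<^bsub>G N\<^esub> C"
    using pad_commute[OF h _ g, of d q p] by (simp add: B_def C_def N_def n_def ac_simps)
  then show ?thesis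
    unfolding 1 2 using closed by (simp add: m_assoc N_def n_def)
qed

end

section \<open>The operad of an operadic cloning system\<close>

context operadic_cloning_system
begin

definition comp_of :: "nat \<Rightarrow> nat \<Rightarrow> nat \<Rightarrow> 'a \<Rightarrow> 'a \<Rightarrow> 'a" where
  "comp_of = (\<lambda>n\<in>{1..}. \<lambda>m\<in>{1..}. \<lambda>i\<in>{1..n}. \<lambda>f\<in>carrier (G n). \<lambda>g\<in>carrier (G m).
    kappa_iter \<kappa> n i m f \<otimes>\<^bsub>G (n + m - 1)\<^esub> nu \<iota> \<zeta> m i n g)"

lemma operad_of_eq: "operad_of (G, \<iota>, \<zeta>, \<kappa>, \<pi>) = (G, \<pi>, comp_of, \<one>\<^bsub>G 1\<^esub>)"
  by (simp add: operad_of_def comp_of_def)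

lemma comp_of_ins:
  "f \<in> carrier (G (Suc (p + q))) \<Longrightarrow> g \<in> carrier (G (Suc r)) \<Longrightarrow>
    comp_of (Suc (p + q)) (Suc r) (Suc p) f g = ins p q r f g"
  by (simp add: comp_of_def kappa_iter_def nu_pad ins_def del: iter_up.simps)

lemma comp_of_closed:
  assumes "n \<ge> 1" "m \<ge> 1" "i \<in> {1..n}" "f \<in> carrier (G n)" "g \<in> carrier (G m)"
  shows "comp_of n m i f g \<in> carrier (G (n + m - 1))"
proof -
  obtain p q where "i = Suc p" "n = Suc (p + q)" by (rule place_cases[OF assms(3)])
  moreover obtain r where "m = Suc r" by (rule pos_cases[OF assms(2)])
  ultimately show ?thesis
    using ins_closed[of f p q g r] assms by (simp add: comp_of_ins)
qed

text \<open>Serves both axioms for disjoint places: \<open>assoc_left\<close> directly, and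
  \<open>assoc_right\<close> read backwards with the two inserted elements exchanged.\<close>

lemma comp_of_assoc_outer:
  assumes "i < j" "1 \<le> i" "j \<le> n" "m \<ge> 1" "l \<ge> 1"
    and f: "f \<in> carrier (G n)" and g: "g \<in> carrier (G m)" and h: "h \<in> carrier (G l)"
  shows "comp_of (n + m - 1) l i (comp_of n m j f g) h
      = comp_of (n + l - 1) m (j + l - 1) (comp_of n l i f h) g"
proof -
  define p d q where "p = i - 1" and "d = j - i - 1" and "q = n - j"
  have n: "i = Suc p" "j = Suc (p + Suc d)" "n = Suc (p + Suc d + q)"
    using assms by (auto simp: p_def d_def q_def)
  define r t where "r = m - 1" and "t = l - 1"
  have m: "m = Suc r" "l = Suc t"
    using assms by (auto simp: r_def t_def)
  have "comp_of n m j f g = ins (p + Suc d) q r f g"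
    using f g unfolding n m by (intro comp_of_ins)
  moreover have "comp_of n l i f h = ins p (Suc d + q) t f h"
    using comp_of_ins[of f p "Suc d + q" h t] f h unfolding n m by (simp add: ac_simps)
  moreover have "comp_of (n + m - 1) l i (ins (p + Suc d) q r f g) h =
      ins p (Suc d + q + r) t (ins (p + Suc d) q r f g) h"
    using comp_of_ins[of "ins (p + Suc d) q r f g" p "Suc d + q + r" h t]
      ins_closed[of f "p + Suc d" q g r] f g h unfolding n m by (simp add: ac_simps)
  moreover have "comp_of (n + l - 1) m (j + l - 1) (ins p (Suc d + q) t f h) g =
      ins (p + Suc d + t) q r (ins p (Suc d + q) t f h) g"
    using comp_of_ins[of "ins p (Suc d + q) t f h" "p + Suc d + t" q g r]
      ins_closed[of f p "Suc d + q" h t] f g h unfolding n m by (simp add: ac_simps)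
  ultimately show ?thesis
    using ins_ins_outer[of f p d q g r h t] f g h unfolding n m by (simp add: ac_simps)
qed

lemma comp_of_assoc_inner:
  assumes "1 \<le> i" "i \<le> n" "i \<le> j" "j \<le> i + m - 1" "m \<ge> 1" "l \<ge> 1"
    and f: "f \<in> carrier (G n)" and g: "g \<in> carrier (G m)" and h: "h \<in> carrier (G l)"
  shows "comp_of (n + m - 1) l j (comp_of n m i f g) h
      = comp_of n (m + l - 1) i f (comp_of m l (j - i + 1) g h)"
proof -
  define p q s u t where "p = i - 1" and "q = n - i" and "s = j - i" and "u = m - 1 - s"
    and "t = l - 1"
  have n: "i = Suc p" "n = Suc (p + q)" "m = Suc (s + u)" "l = Suc t" "j = Suc (p + s)"
    using assms by (auto simp: p_def q_def s_def u_def t_def)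
  have "comp_of n m i f g = ins p q (s + u) f g"
    using f g unfolding n by (intro comp_of_ins)
  moreover have "comp_of m l (j - i + 1) g h = ins s u t g h"
    using comp_of_ins[of g s u h t] g h unfolding n by simp
  moreover have "comp_of (n + m - 1) l j (ins p q (s + u) f g) h =
      ins (p + s) (q + u) t (ins p q (s + u) f g) h"
    using comp_of_ins[of "ins p q (s + u) f g" "p + s" "q + u" h t]
      ins_closed[of f p q g "s + u"] f g h unfolding n by (simp add: ac_simps)
  moreover have "comp_of n (m + l - 1) i f (ins s u t g h) = ins p q (s + u + t) f (ins s u t g h)"
    using comp_of_ins[of f p q "ins s u t g h" "s + u + t"]
      ins_closed[of g s u h t] f g h unfolding n by (simp add: ac_simps)
  ultimately show ?thesis
    using ins_ins_inner[of f p q g s u h t] f g h unfolding n by simp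
qed

lemma operad_over_sym_comp_of: "operad_over_sym G \<pi> comp_of \<one>\<^bsub>G 1\<^esub>"
proof (intro operad_over_sym.intro operad_over_sym_axioms.intro groups_over_sym_axioms)
  show "comp_of \<in> (\<Pi>\<^sub>E n\<in>{1..}. \<Pi>\<^sub>E m\<in>{1..}. \<Pi>\<^sub>E i\<in>{1..n}.
      carrier (G n) \<rightarrow>\<^sub>E carrier (G m) \<rightarrow>\<^sub>E carrier (G (n + m - 1)))"
    using comp_of_closed by (simp add: PiE_iff) (simp add: comp_of_def)
  show "\<one>\<^bsub>G 1\<^esub> \<in> carrier (G 1)" by (simp add: one_closed)
next
  fix n m l i j :: nat and f g h
  assume a: "n \<ge> 1" "m \<ge> 1" "l \<ge> 1" "f \<in> carrier (G n)" "g \<in> carrier (G m)" "h \<in> carrier (G l)"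
    "i \<in> {1..n}" "j \<in> {1..n + m - 1}"
  show "comp_of (n + m - 1) l j (comp_of n m i f g) h
      = comp_of (n + l - 1) m (i + l - 1) (comp_of n l j f h) g" if "j < i"
    using a that by (intro comp_of_assoc_outer) auto
  show "comp_of (n + m - 1) l j (comp_of n m i f g) h
      = comp_of (n + l - 1) m i (comp_of n l (j - m + 1) f h) g" if "j \<ge> i + m"
    using comp_of_assoc_outer[of i "j - m + 1" n l m f h g] a that by auto
  show "comp_of (n + m - 1) l j (comp_of n m i f g) h
      = comp_of n (m + l - 1) i f (comp_of m l (j - i + 1) g h)" if "i \<le> j" "j \<le> i + m - 1"
    using a that by (intro comp_of_assoc_inner) auto
next
  fix n i :: nat and f
  assume a: "n \<ge> 1" "f \<in> carrier (G n)" "i \<in> {1..n}"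
  obtain p q where n: "i = Suc p" "n = Suc (p + q)" by (rule place_cases[OF a(3)])
  have "comp_of n 1 i f \<one>\<^bsub>G 1\<^esub> = ins p q 0 f \<one>\<^bsub>G 1\<^esub>"
    using comp_of_ins[of f p q "\<one>\<^bsub>G 1\<^esub>" 0] a one_closed[of 1] by (simp add: n)
  also have "\<dots> = f"
    using pad_one[of 1 q p] a by (simp add: ins_def n r_one ac_simps)
  finally show "comp_of n 1 i f \<one>\<^bsub>G 1\<^esub> = f" .
next
  fix m :: nat and g
  assume a: "m \<ge> 1" "g \<in> carrier (G m)"
  obtain r where m: "m = Suc r" by (rule pos_cases[OF a(1)])
  have "comp_of 1 m 1 \<one>\<^bsub>G 1\<^esub> g = ins 0 0 r \<one>\<^bsub>G 1\<^esub> g"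
    using comp_of_ins[of "\<one>\<^bsub>G 1\<^esub>" 0 0 g r] a one_closed[of 1] by (simp add: m)
  also have "\<dots> = g"
    using dup_one[of 1 1 r] a by (simp add: ins_def m l_one)
  finally show "comp_of 1 m 1 \<one>\<^bsub>G 1\<^esub> g = g" .
next
  fix n m i :: nat and f f' g g'
  assume a: "n \<ge> 1" "m \<ge> 1" "f \<in> carrier (G n)" "f' \<in> carrier (G n)"
    "g \<in> carrier (G m)" "g' \<in> carrier (G m)" "i \<in> {1..n}"
  obtain p q where n: "i = Suc p" "n = Suc (p + q)" by (rule place_cases[OF a(7)])
  obtain r where m: "m = Suc r" by (rule pos_cases[OF a(2)])
  obtain p' q' where p': "\<pi> n f' i = Suc p'" "n = Suc (p' + q')"
    by (rule place_cases[OF pi_in[OF a(1,4,7)]])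
  then have pq: "p' + q' = p + q" using n by simp
  show "comp_of n m i (f \<otimes>\<^bsub>G n\<^esub> f') (g \<otimes>\<^bsub>G m\<^esub> g')
      = comp_of n m (\<pi> n f' i) f g \<otimes>\<^bsub>G (n + m - 1)\<^esub> comp_of n m i f' g'"
    using ins_mult[of f p q f' g r g' p' q'] comp_of_ins[of f p' q' g r]
      comp_of_ins[of f' p q g' r] comp_of_ins[of "f \<otimes>\<^bsub>G n\<^esub> f'" p q "g \<otimes>\<^bsub>G m\<^esub> g'" r]
      m_closed[of n f f'] m_closed[of m g g'] a p'(1) pq
    by (simp add: n m)
qed

text \<open>Isolates the action of the cloned f. It is the identity for \<open>f = \<one>\<close>,
  is known off the block in general, and is fully known in the restricted case; these give
  \<open>pi_comp_one\<close>, (2') and (2) respectively.\<close>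

lemma pi_comp_of:
  assumes "n \<ge> 1" "m \<ge> 1" and f: "f \<in> carrier (G n)" and g: "g \<in> carrier (G m)" and i: "i \<in> {1..n}"
  shows "\<pi> (n + m - 1) (comp_of n m i f g)
      = \<pi> (n + m - 1) (dup n i (m - 1) f) \<circ> sym_comp n m i id (\<pi> m g)"
proof -
  obtain p q where n: "i = Suc p" "n = Suc (p + q)" by (rule place_cases[OF i])
  obtain r where m: "m = Suc r" by (rule pos_cases[OF assms(2)])
  have "sym_comp n m i id (\<pi> m g) = \<pi> (Suc (p + q + r)) (pad (Suc r) p q g)"
    using sym_comp_one[OF pi_permutes[OF _ g], of i n] pi_ins_pad[of g r p q] g i
    by (simp add: n m fun_eq_iff Suc_le_eq)
  moreover have "comp_of n m i f g = ins p q r f g"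
    using f g by (simp add: n m comp_of_ins)
  ultimately show ?thesis
    using pi_mult[OF _ ins_dup_closed[of f p q r] ins_pad_closed[of g r q p]] f g
    by (simp add: ins_def n m)
qed

lemma general_action_operad_comp_of: "general_action_operad G \<pi> comp_of \<one>\<^bsub>G 1\<^esub>"
proof (intro general_action_operad.intro general_action_operad_axioms.intro
    operad_over_sym_comp_of)
  fix n m i k :: nat and f g
  assume a: "n \<ge> 1" "m \<ge> 1" "f \<in> carrier (G n)" "g \<in> carrier (G m)" "i \<in> {1..n}"
    and k: "k \<in> {1..n + m - 1} - {i..i + m - 1}"
  have "\<pi> m g (k - (i - 1)) = k - (i - 1)" if "i \<le> k"
    using that k a(2,5) by (intro permutes_not_in[OF pi_permutes[OF a(2,4)]]) auto
  then have "sym_comp n m i id (\<pi> m g) k = k"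
    using sym_comp_one[OF pi_permutes[OF a(2,4)] a(2,5)] a(5) by auto
  \<comment> \<open>The free \<tau> of \<open>pi_dup_outside\<close> is taken to be
    \<open>\<pi> m g\<close>, to match (2') literally.\<close>
  moreover have "\<pi> (n + (m - 1)) (dup n i (m - 1) f) k = sym_comp n (Suc (m - 1)) i (\<pi> n f) (\<pi> m g) k"
    using a k by (intro pi_dup_outside) auto
  ultimately show "sym_comp n m i (\<pi> n f) (\<pi> m g) k = \<pi> (n + m - 1) (comp_of n m i f g) k"
    unfolding pi_comp_of[OF a] using a by simp
qed

lemma pi_comp_one_comp_of: "pi_comp_one (G, \<pi>, comp_of, \<one>\<^bsub>G 1\<^esub>)"
proof -
  have "\<pi> (n + m - 1) (comp_of n m i \<one>\<^bsub>G n\<^esub> h) = sym_comp n m i (\<pi> n \<one>\<^bsub>G n\<^esub>) (\<pi> m h)"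
    if a: "n \<ge> 1" "m \<ge> 1" "i \<in> {1..n}" "h \<in> carrier (G m)" for n m i h
  proof -
    have "n + (m - 1) \<ge> 1" using a(1) by linarith
    from pi_one[OF this] have "\<pi> (n + m - 1) (dup n i (m - 1) \<one>\<^bsub>G n\<^esub>) = id"
      using dup_one[of n i "m - 1"] a by simp
    then show ?thesis
      using pi_comp_of[OF a(1,2) one_closed a(4,3)] a by (simp add: pi_one)
  qed
  then show ?thesis by (simp add: pi_comp_one_def)
qed

text \<open>In each composite with e_2 one factor is an identity, by \<open>dup_one\<close> or
  \<open>pad_one\<close>; the other is a single application of \<iota>, \<zeta> or \<kappa>.\<close>

lemma cloning_of_operad_of:
  "cloning_of (operad_of (G, \<iota>, \<zeta>, \<kappa>, \<pi>)) = (G, \<iota>, \<zeta>, \<kappa>, \<pi>)"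
proof -
  have e: "\<one>\<^bsub>G 2\<^esub> \<in> carrier (G 2)" by (simp add: one_closed)
  have eqs: "comp_of 2 n 1 \<one>\<^bsub>G 2\<^esub> g = \<iota> n g" "comp_of 2 n 2 \<one>\<^bsub>G 2\<^esub> g = \<zeta> n g"
    if n1: "n \<in> {1..}" and g: "g \<in> carrier (G n)" for n g
  proof -
    obtain r where n: "n = Suc r" using n1 by (cases n) auto
    show "comp_of 2 n 1 \<one>\<^bsub>G 2\<^esub> g = \<iota> n g"
      using comp_of_ins[of "\<one>\<^bsub>G 2\<^esub>" 0 1 g r] dup_one[of 2 1 r] iota_closed[of n g] e g
      by (simp add: n ins_def l_one flip: numeral_2_eq_2)
    show "comp_of 2 n 2 \<one>\<^bsub>G 2\<^esub> g = \<zeta> n g"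
      using comp_of_ins[of "\<one>\<^bsub>G 2\<^esub>" 1 0 g r] dup_one[of 2 2 r] zeta_closed[of n g] e g
      by (simp add: n ins_def l_one flip: numeral_2_eq_2)
  qed
  have kap: "comp_of n 2 j g \<one>\<^bsub>G 2\<^esub> = \<kappa> n j g"
    if nj: "n \<in> {1..}" "j \<in> {1..n}" and g: "g \<in> carrier (G n)" for n j g
  proof -
    obtain p q where n: "j = Suc p" "n = Suc (p + q)" by (rule place_cases[OF nj(2)])
    have "comp_of n 2 j g \<one>\<^bsub>G 2\<^esub> = ins p q 1 g \<one>\<^bsub>G 2\<^esub>"
      using comp_of_ins[of g p q "\<one>\<^bsub>G 2\<^esub>" 1] e g by (simp add: n flip: numeral_2_eq_2)
    also have "\<dots> = \<kappa> n j g"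
      using pad_one[of 2 q p] kappa_closed[of n g j] g
      by (simp add: n ins_def r_one ac_simps flip: numeral_2_eq_2)
    finally show ?thesis .
  qed
  have "(\<lambda>n\<in>{1..}. \<lambda>g\<in>carrier (G n). comp_of 2 n 1 \<one>\<^bsub>G 2\<^esub> g) = \<iota>"
    by (rule restrict_eqI[OF iota_type], rule restrict_eqI[OF PiE_mem[OF iota_type]], assumption,
        rule eqs)
  moreover have "(\<lambda>n\<in>{1..}. \<lambda>g\<in>carrier (G n). comp_of 2 n 2 \<one>\<^bsub>G 2\<^esub> g) = \<zeta>"
    by (rule restrict_eqI[OF zeta_type], rule restrict_eqI[OF PiE_mem[OF zeta_type]], assumption,
        rule eqs)
  moreover have "(\<lambda>n\<in>{1..}. \<lambda>j\<in>{1..n}. \<lambda>g\<in>carrier (G n). comp_of n 2 j g \<one>\<^bsub>G 2\<^esub>) = \<kappa>"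
    by (rule restrict_eqI[OF kappa_type], rule restrict_eqI[OF PiE_mem[OF kappa_type]], assumption,
        rule restrict_eqI[OF PiE_mem[OF PiE_mem[OF kappa_type]]], assumption, assumption, rule kap)
  ultimately show ?thesis
    by (simp only: operad_of_eq cloning_of_def prod.case)
qed

end

section \<open>The restricted case: full compatibility with \<pi>\<close>

context restricted_operadic_cloning_system
begin

lemma pi_dup:
  assumes n: "n \<ge> 1" and g: "g \<in> carrier (G n)" and j: "1 \<le> j" "j \<le> n"
  shows "\<pi> (n + r) (dup n j r g) = sym_comp n (Suc r) j (\<pi> n g) id"
proof (induction r)
  case 0
  have "\<pi> n g j \<ge> 1" using pi_in[OF n g, of j] j by simp
  then show ?case
    using permutes_not_in[OF pi_permutes[OF n g]]
    by (auto simp: fun_eq_iff sym_comp_def Let_def)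
next
  case (Suc r)
  have eq: "\<pi> (n + Suc r) (dup n j (Suc r) g) = sym_clone (n + r) j (\<pi> (n + r) (dup n j r g))"
    using pi_kappa[of "n + r" "dup n j r g" j] dup_closed[OF n g j, of r] n j by simp
  show ?case
    unfolding eq Suc by (rule sym_clone_sym_comp[OF pi_permutes[OF n g]]) (use j in simp)
qed

lemma action_operad_comp_of: "action_operad G \<pi> comp_of \<one>\<^bsub>G 1\<^esub>"
proof (intro action_operad.intro action_operad_axioms.intro operad_over_sym_comp_of)
  show "\<pi> 1 \<one>\<^bsub>G 1\<^esub> = id" by (simp add: pi_one)
next
  fix n m i :: nat and f g
  assume a: "n \<ge> 1" "m \<ge> 1" "f \<in> carrier (G n)" "g \<in> carrier (G m)" "i \<in> {1..n}"
  then show "\<pi> (n + m - 1) (comp_of n m i f g) = sym_comp n m i (\<pi> n f) (\<pi> m g)"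
    using pi_dup[of n f i "m - 1"]
      sym_comp_decomp[OF pi_permutes[OF a(1,3)] pi_permutes[OF a(2,4)] a(2,5)]
    unfolding pi_comp_of[OF a] by simp
qed

end

section \<open>From action operads to restricted systems\<close>

context action_operad
begin

lemma general_action_operad: "general_action_operad G \<pi> comp unit"
  by (intro general_action_operad.intro general_action_operad_axioms.intro operad_over_sym_axioms)
    (simp add: pi_comp[simplified])

lemma pi_comp_one: "pi_comp_one (G, \<pi>, comp, unit)"
  by (simp add: pi_comp_one_def pi_comp[simplified] one_closed)

lemma restricted_operadic_cloning_system_of_comp:
  "restricted_operadic_cloning_system G \<pi>
      (\<lambda>n\<in>{1..}. \<lambda>g\<in>carrier (G n). comp 2 n 1 (e 2) g)
      (\<lambda>n\<in>{1..}. \<lambda>j\<in>{1..n}. \<lambda>g\<in>carrier (G n). comp n 2 j g (e 2))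
      (\<lambda>n\<in>{1..}. \<lambda>g\<in>carrier (G n). comp 2 n 2 (e 2) g)"
proof (intro restricted_operadic_cloning_system.intro
    restricted_operadic_cloning_system_axioms.intro
    general_action_operad.operadic_cloning_system_of_comp[OF general_action_operad])
  fix n m i :: nat and h
  assume "n \<ge> 1" "m \<ge> 1" "i \<in> {1..n}" "h \<in> carrier (G m)"
  then show "\<pi> (n + m - 1) (comp n m i (e n) h) = sym_comp n m i (\<pi> n (e n)) (\<pi> m h)"
    by (simp add: pi_comp[simplified] one_closed)
next
  fix n j :: nat and g
  assume "n \<ge> 1" "g \<in> carrier (G n)" "j \<in> {1..n}"
  then show "\<pi> (n + 1) ((\<lambda>n\<in>{1..}. \<lambda>j\<in>{1..n}. \<lambda>g\<in>carrier (G n). comp n 2 j g (e 2)) n j g)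
      = sym_clone n j (\<pi> n g)"
    using pi_comp[of n 2 g "e 2" j] sym_comp_two[OF pi_permutes, of n g j]
    by (simp add: one_closed pi_one)
qed

end

section \<open>The correspondence\<close>

lemma action_operads_subset:
  "action_operads \<subseteq> {A \<in> general_action_operads. pi_comp_one A}"
  by (auto simp: action_operads_def general_action_operads_def
      intro: action_operad.general_action_operad action_operad.pi_comp_one)

lemma restricted_operadic_cloning_systems_subset:
  "restricted_operadic_cloning_systems \<subseteq> operadic_cloning_systems"
  by (auto simp: restricted_operadic_cloning_systems_def operadic_cloning_systems_def
      dest: restricted_operadic_cloning_system.axioms(1))

lemma operad_of_cloning_of_general:
  assumes "A \<in> general_action_operads"
  shows "operad_of (cloning_of A) = A"
proof -
  obtain G \<pi> comp unit where A: "A = (G, \<pi>, comp, unit)" by (cases A)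
  with assms have "general_action_operad G \<pi> comp unit"
    by (simp add: general_action_operads_def)
  then show ?thesis
    unfolding A by (intro operad_over_sym.operad_of_cloning_of general_action_operad.axioms(1))
qed

lemma cloning_of_operad_of_operadic:
  assumes "C \<in> operadic_cloning_systems"
  shows "cloning_of (operad_of C) = C"
proof -
  obtain G \<iota> \<zeta> \<kappa> \<pi> where C: "C = (G, \<iota>, \<zeta>, \<kappa>, \<pi>)" by (cases C)
  with assms have "operadic_cloning_system G \<pi> \<iota> \<kappa> \<zeta>"
    by (simp add: operadic_cloning_systems_def)
  then show ?thesis
    unfolding C by (rule operadic_cloning_system.cloning_of_operad_of)
qed

lemma cloning_of_action_operads:
  "cloning_of ` action_operads \<subseteq> restricted_operadic_cloning_systems"
proof
  fix C assume "C \<in> cloning_of ` action_operads"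
  then obtain G \<pi> comp unit where C: "C = cloning_of (G, \<pi>, comp, unit)"
    and "action_operad G \<pi> comp unit"
    by (auto simp: action_operads_def)
  then interpret action_operad G \<pi> comp unit by simp
  show "C \<in> restricted_operadic_cloning_systems"
    using restricted_operadic_cloning_system_of_comp
    unfolding C cloning_of_def restricted_operadic_cloning_systems_def by simp
qed

lemma operad_of_restricted_operadic_cloning_systems:
  "operad_of ` restricted_operadic_cloning_systems \<subseteq> action_operads"
proof
  fix A assume "A \<in> operad_of ` restricted_operadic_cloning_systems"
  then obtain G \<iota> \<zeta> \<kappa> \<pi> where A: "A = operad_of (G, \<iota>, \<zeta>, \<kappa>, \<pi>)"
    and "restricted_operadic_cloning_system G \<pi> \<iota> \<kappa> \<zeta>"
    by (auto simp: restricted_operadic_cloning_systems_def)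
  then interpret restricted_operadic_cloning_system G \<pi> \<iota> \<kappa> \<zeta> by simp
  show "A \<in> action_operads"
    using action_operad_comp_of unfolding A operad_of_eq action_operads_def by simp
qed

lemma cloning_of_general_action_operads:
  "cloning_of ` {A \<in> general_action_operads. pi_comp_one A} \<subseteq> operadic_cloning_systems"
proof
  fix C assume "C \<in> cloning_of ` {A \<in> general_action_operads. pi_comp_one A}"
  then obtain G \<pi> comp unit where C: "C = cloning_of (G, \<pi>, comp, unit)"
    and "general_action_operad G \<pi> comp unit" and one: "pi_comp_one (G, \<pi>, comp, unit)"
    by (auto simp: general_action_operads_def)
  then interpret general_action_operad G \<pi> comp unit by simp
  show "C \<in> operadic_cloning_systems"
    using operadic_cloning_system_of_comp one
    unfolding C cloning_of_def operadic_cloning_systems_def pi_comp_one_def by simp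
qed

lemma operad_of_operadic_cloning_systems:
  "operad_of ` operadic_cloning_systems \<subseteq> {A \<in> general_action_operads. pi_comp_one A}"
proof
  fix A assume "A \<in> operad_of ` operadic_cloning_systems"
  then obtain G \<iota> \<zeta> \<kappa> \<pi> where A: "A = operad_of (G, \<iota>, \<zeta>, \<kappa>, \<pi>)"
    and "operadic_cloning_system G \<pi> \<iota> \<kappa> \<zeta>"
    by (auto simp: operadic_cloning_systems_def)
  then interpret operadic_cloning_system G \<pi> \<iota> \<kappa> \<zeta> by simp
  show "A \<in> {A \<in> general_action_operads. pi_comp_one A}"
    using general_action_operad_comp_of pi_comp_one_comp_of
    unfolding A operad_of_eq general_action_operads_def by simp
qed

text \<open>Each bijection combines the two round trips with the inclusions of the images. General
  action operads are cut down by \<open>pi_comp_one\<close>, because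
  \<open>cloning_of_general_action_operad_fails\<close> exhibits one that is sent outside the
  operadic cloning systems.\<close>

theorem theorem6p3:
  shows "(\<forall>A \<in> (action_operads \<union> general_action_operads :: 'a operad_data set).
            operad_of (cloning_of A) = A)
       \<and> (\<forall>C \<in> (operadic_cloning_systems :: 'a cloning_data set).
            cloning_of (operad_of C) = C)
       \<and> bij_betw cloning_of (action_operads :: 'a operad_data set)
            restricted_operadic_cloning_systems
       \<and> bij_betw operad_of (restricted_operadic_cloning_systems :: 'a cloning_data set)
            action_operads
       \<and> bij_betw cloning_of {A \<in> (general_action_operads :: 'a operad_data set). pi_comp_one A}
            operadic_cloning_systems
       \<and> bij_betw operad_of (operadic_cloning_systems :: 'a cloning_data set)
            {A \<in> general_action_operads. pi_comp_one A}"
proof (intro conjI ballI)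
  show "operad_of (cloning_of A) = A"
    if "A \<in> action_operads \<union> general_action_operads" for A :: "'a operad_data"
    using that action_operads_subset operad_of_cloning_of_general by blast
  show "cloning_of (operad_of C) = C" if "C \<in> operadic_cloning_systems" for C :: "'a cloning_data"
    using that by (rule cloning_of_operad_of_operadic)
  have inv: "\<forall>A\<in>{A \<in> general_action_operads. pi_comp_one A}.
      operad_of (cloning_of A) = (A :: 'a operad_data)"
    using operad_of_cloning_of_general by blast
  have inv': "\<forall>C\<in>operadic_cloning_systems. cloning_of (operad_of C) = (C :: 'a cloning_data)"
    using cloning_of_operad_of_operadic by blast
  have rinv: "\<forall>A\<in>action_operads. operad_of (cloning_of A) = (A :: 'a operad_data)"
    using inv action_operads_subset by blast
  have rinv': "\<forall>C\<in>restricted_operadic_cloning_systems.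
      cloning_of (operad_of C) = (C :: 'a cloning_data)"
    using inv' restricted_operadic_cloning_systems_subset by blast
  show "bij_betw cloning_of (action_operads :: 'a operad_data set)
      restricted_operadic_cloning_systems"
    by (rule bij_betw_byWitness[OF rinv rinv' cloning_of_action_operads
          operad_of_restricted_operadic_cloning_systems])
  show "bij_betw operad_of (restricted_operadic_cloning_systems :: 'a cloning_data set)
      action_operads"
    by (rule bij_betw_byWitness[OF rinv' rinv operad_of_restricted_operadic_cloning_systems
          cloning_of_action_operads])
  show "bij_betw cloning_of {A \<in> (general_action_operads :: 'a operad_data set). pi_comp_one A}
      operadic_cloning_systems"
    by (rule bij_betw_byWitness[OF inv inv' cloning_of_general_action_operads
          operad_of_operadic_cloning_systems])
  show "bij_betw operad_of (operadic_cloning_systems :: 'a cloning_data set)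
      {A \<in> general_action_operads. pi_comp_one A}"
    by (rule bij_betw_byWitness[OF inv' inv operad_of_operadic_cloning_systems
          cloning_of_general_action_operads])
qed

end
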